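(* Let $p$ be a prime, $1\le r\le q<\infty$, $\delta>0$, $\nu>0$, $\gamma\in\mathbb{R}$ and $\beta\in[0,1)$. For $s\in\mathbb{Q}_p^*$ let $$I^{\nu}_{\gamma,\delta}f(s)=\frac{|s|_p^{-\nu(\gamma+\delta)}}{\Gamma(\delta)}\int_{\{t\in\mathbb{Q}_p^*:\,|t|_p<|s|_p\}}|t|_p^{\nu(\gamma+1)-1}\left(|s|_p^\nu-|t|_p^\nu\right)^{\delta-1}f(t)\,dt,$$ $$J^{\nu}_{\gamma,\delta}f(s)=\frac{|s|_p^{\nu\gamma}}{\Gamma(\delta)}\int_{\{t\in\mathbb{Q}_p^*:\,|t|_p>|s|_p\}}|t|_p^{-\nu(\gamma+\delta)+\nu-1}\left(|t|_p^\nu-|s|_p^\nu\right)^{\delta-1}f(t)\,dt$$ be the $p$-adic Erdélyi–Kober fractional integrals of the first and second kind. (1) If $\nu(\gamma+1)>\beta+\frac1q$, then there exists a constant $C>0$ such that for any $f\in C^{\beta}M_{r,q}(\mathbb{Q}_p)$, $$\|I^{\nu}_{\gamma,\delta}f\|_{C^{\beta}M_{r,q}(\mathbb{Q}_p)}\le C\|f\|_{C^{\beta}M_{r,q}(\mathbb{Q}_p)}.$$ (2) If $\nu\gamma+\beta>-\frac1q$, then there exists a constant $C>0$ such that for any $f\in C^{\beta}M_{r,q}(\mathbb{Q}_p)$, $$\|J^{\nu}_{\gamma,\delta}f\|_{C^{\beta}M_{r,q}(\mathbb{Q}_p)}\le C\|f\|_{C^{\beta}M_{r,q}(\mathbb{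Q}_p)}.$$
   Context: $\mathbb{Q}_p$ is the field of $p$-adic numbers with the $p$-adic absolute value $|\cdot|_p$, $\mathbb{Q}_p^*=\mathbb{Q}_p\setminus\{0\}$, and $dx$ is the Haar measure on $(\mathbb{Q}_p,+)$ normalized so that $\{x:|x|_p\le 1\}$ has measure $1$; $|E|$ denotes the measure of $E$. $\Gamma$ is the Euler Gamma function. For $a\in\mathbb{Q}_p$, $\ell\in\mathbb{Z}$, let $B^\ell(a)=\{x\in\mathbb{Q}_p:|x-a|_p\le p^\ell\}$, so $|B^\ell(a)|=p^\ell$. For $1\le r\le q<\infty$ and $0\le\beta<1$, the fractional Cesàro–Morrey space $C^{\beta}M_{r,q}(\mathbb{Q}_p)$ consists of all locally integrable functions $f$ on $\mathbb{Q}_p$ with $\|f\|_{C^{\beta}M_{r,q}(\mathbb{Q}_p)}<\infty$, where for measurable $f$ (with values in $[0,\infty]$) $$\|f\|_{C^{\beta}M_{r,q}(\mathbb{Q}_p)}=\sup_{a\in\mathbb{Q}_p,\ \ell\in\mathbb{Z}}|B^\ell(a)|^{\frac1q-\frac1r}\left(\int_{B^\ell(a)}\left(\frac{1}{|x|_p^{1-\beta}}\int_{|t|_p\le|x|_p}|f(t)|\,dt\right)^r dx\right)^{1/r}.$$ *)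

theory Defs
  imports "Berlekamp_Zassenhaus.Finite_Field" "HOL-Analysis.Analysis"
begin

section \<open>The \<open>p\<close>-adic absolute value on the rationals\<close>

definition rat_padic_val :: "nat \<Rightarrow> rat \<Rightarrow> int" where
  "rat_padic_val p x = (case quotient_of x of (a, b) \<Rightarrow>
     int (multiplicity (int p) a) - int (multiplicity (int p) b))"

definition rat_padic_abs :: "nat \<Rightarrow> rat \<Rightarrow> real" where
  "rat_padic_abs p x = (if x = 0 then 0 else real p powi (- rat_padic_val p x))"

lemma rat_padic_val_Fract:
  assumes "prime p" "a \<noteq> 0" "b \<noteq> 0"
  shows "rat_padic_val p (Rat.Fract a b) = int (multiplicity (int p) a) - int (multiplicity (int p) b)"
proof -
  have pr: "prime_elem (int p)" using assms(1) by auto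
  obtain c d where cd: "quotient_of (Rat.Fract a b) = (c, d)" by (cases "quotient_of (Rat.Fract a b)")
  then have d: "d > 0" using quotient_of_denom_pos by blast
  have eq: "Rat.Fract a b = Rat.Fract c d"
    using quotient_of_div[OF cd] by (simp add: Fract_of_int_quotient)
  then have m: "a * d = c * b" using assms d by (simp add: eq_rat)
  then have c: "c \<noteq> 0" using assms d by auto
  have "multiplicity (int p) (a * d) = multiplicity (int p) (c * b)" using m by simp
  then have "multiplicity (int p) a + multiplicity (int p) d = multiplicity (int p) c + multiplicity (int p) b"
    using assms c d pr by (simp add: prime_elem_multiplicity_mult_distrib)
  then show ?thesis by (simp add: rat_padic_val_def cd)
qed

lemma rat_padic_abs_0 [simp]: "rat_padic_abs p 0 = 0"
  by (simp add: rat_padic_abs_def)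

lemma rat_padic_abs_nonneg [simp]: "rat_padic_abs p x \<ge> 0"
  by (simp add: rat_padic_abs_def)

lemma rat_padic_abs_eq_0_iff [simp]: "prime p \<Longrightarrow> rat_padic_abs p x = 0 \<longleftrightarrow> x = 0"
  using prime_gt_0_nat by (auto simp: rat_padic_abs_def)

lemma rat_padic_abs_1 [simp]: "rat_padic_abs p 1 = 1"
  by (simp add: rat_padic_abs_def rat_padic_val_def)

lemma rat_common_denom:
  fixes x y :: rat
  obtains a b d where "x = Rat.Fract a d" "y = Rat.Fract b d" "d > 0"
proof -
  obtain a b where x: "x = Rat.Fract a b" "b > 0" by (cases x) auto
  obtain c d where y: "y = Rat.Fract c d" "d > 0" by (cases y) auto
  have "x = Rat.Fract (a * d) (b * d)" "y = Rat.Fract (c * b) (b * d)" "b * d > 0"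
    using x y by (auto simp: eq_rat)
  then show ?thesis using that by blast
qed

lemma rat_padic_abs_mult:
  assumes p: "prime p"
  shows "rat_padic_abs p (x * y) = rat_padic_abs p x * rat_padic_abs p y"
proof (cases "x = 0 \<or> y = 0")
  case False
  have pr: "prime_elem (int p)" using p by auto
  obtain a d b where x: "x = Rat.Fract a d" and y: "y = Rat.Fract b d" and d: "d > 0"
    by (rule rat_common_denom)
  have nz: "a \<noteq> 0" "b \<noteq> 0" using False x y by (auto simp: rat_number_collapse)
  have "rat_padic_val p (x * y) = rat_padic_val p x + rat_padic_val p y"
    using nz d p pr by (simp add: x y rat_padic_val_Fract prime_elem_multiplicity_mult_distrib)
  then show ?thesis
    using False prime_gt_0_nat[OF p] by (simp add: rat_padic_abs_def power_int_diff power_int_minus divide_inverse)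
qed auto

lemma rat_padic_abs_minus [simp]:
  assumes p: "prime p" shows "rat_padic_abs p (- x) = rat_padic_abs p x"
proof -
  have "rat_padic_abs p (-1) ^ 2 = 1"
    using rat_padic_abs_mult[OF p, of "-1" "-1"] by (simp add: power2_eq_square)
  then have "rat_padic_abs p (-1) = 1"
    using rat_padic_abs_nonneg[of p "-1"] by (metis abs_of_nonneg power2_eq_1_iff abs_1 abs_minus)
  then show ?thesis using rat_padic_abs_mult[OF p, of "-1" x] by simp
qed

lemma rat_padic_abs_minus_commute: "prime p \<Longrightarrow> rat_padic_abs p (x - y) = rat_padic_abs p (y - x)"
  using rat_padic_abs_minus[of p "x - y"] by simp

lemma rat_padic_abs_add_max:
  assumes p: "prime p"
  shows "rat_padic_abs p (x + y) \<le> max (rat_padic_abs p x) (rat_padic_abs p y)"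
proof (cases "x = 0 \<or> y = 0 \<or> x + y = 0")
  case False
  have p1: "real p \<ge> 1" using prime_gt_0_nat[OF p] by simp
  have nu: "\<not> is_unit (int p)" using p by auto
  obtain a d b where x: "x = Rat.Fract a d" and y: "y = Rat.Fract b d" and d: "d > 0"
    by (rule rat_common_denom)
  have xy: "x + y = Rat.Fract (a + b) d"
    using d by (simp add: x y eq_rat algebra_simps)
  have nz: "a \<noteq> 0" "b \<noteq> 0" "a + b \<noteq> 0"
    using False x y xy by (auto simp: rat_number_collapse)
  define k where "k = min (multiplicity (int p) a) (multiplicity (int p) b)"
  have "int p ^ k dvd a" "int p ^ k dvd b"
    by (simp_all add: k_def multiplicity_dvd')
  then have "int p ^ k dvd a + b" by simp
  then have "k \<le> multiplicity (int p) (a + b)"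
    using nz nu by (intro multiplicity_geI) auto
  then have "- rat_padic_val p (x + y) \<le> - rat_padic_val p x
      \<or> - rat_padic_val p (x + y) \<le> - rat_padic_val p y"
    using nz d p unfolding xy by (auto simp: x y rat_padic_val_Fract k_def)
  then show ?thesis
    using False p1 by (auto simp: rat_padic_abs_def le_max_iff_disj intro: power_int_increasing)
qed (auto simp: le_max_iff_disj)

lemma rat_padic_abs_add:
  "prime p \<Longrightarrow> rat_padic_abs p (x + y) \<le> rat_padic_abs p x + rat_padic_abs p y"
  by (rule order_trans[OF rat_padic_abs_add_max]) auto

lemma rat_padic_abs_diff_trans:
  "prime p \<Longrightarrow> rat_padic_abs p (x - z) \<le> rat_padic_abs p (x - y) + rat_padic_abs p (y - z)"
  using rat_padic_abs_add[of p "x - y" "y - z"] by simp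

lemma rat_padic_abs_triangle3:
  "prime p \<Longrightarrow> \<bar>rat_padic_abs p x - rat_padic_abs p y\<bar> \<le> rat_padic_abs p (x - y)"
  using rat_padic_abs_add[of p y "x - y"] rat_padic_abs_add[of p x "y - x"]
    rat_padic_abs_minus_commute[of p x y] by simp

lemma rat_padic_abs_inverse:
  assumes "prime p" shows "rat_padic_abs p (inverse x) = inverse (rat_padic_abs p x)"
proof (cases "x = 0")
  case False
  then show ?thesis
    using rat_padic_abs_mult[OF assms, of x "inverse x"] assms
    by (simp add: inverse_eq_divide field_simps)
qed auto


section \<open>The field of \<open>p\<close>-adic numbers as the completion of the rationals\<close>

definition padic_Cauchy :: "nat \<Rightarrow> (nat \<Rightarrow> rat) \<Rightarrow> bool" where
  "padic_Cauchy p X \<longleftrightarrow> (\<forall>e>0. \<exists>N. \<forall>m\<ge>N. \<forall>n\<ge>N. rat_padic_abs p (X m - X n) < e)"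

definition padic_null :: "nat \<Rightarrow> (nat \<Rightarrow> rat) \<Rightarrow> bool" where
  "padic_null p X \<longleftrightarrow> (\<lambda>n. rat_padic_abs p (X n)) \<longlonglongrightarrow> 0"

definition padic_rel :: "nat \<Rightarrow> (nat \<Rightarrow> rat) \<Rightarrow> (nat \<Rightarrow> rat) \<Rightarrow> bool" where
  "padic_rel p X Y \<longleftrightarrow> padic_Cauchy p X \<and> padic_Cauchy p Y \<and> padic_null p (\<lambda>n. X n - Y n)"

lemma padic_Cauchy_const [simp]: "padic_Cauchy p (\<lambda>n. c)"
  by (simp add: padic_Cauchy_def)

lemma padic_Cauchy_dominated:
  assumes "padic_Cauchy p X"
    and "\<And>m n. rat_padic_abs p (Y m - Y n) \<le> rat_padic_abs p (X m - X n)"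
  shows "padic_Cauchy p Y"
  using assms unfolding padic_Cauchy_def by (meson le_less_trans)

lemma padic_Cauchy_minus: "prime p \<Longrightarrow> padic_Cauchy p X \<Longrightarrow> padic_Cauchy p (\<lambda>n. - X n)"
  by (erule padic_Cauchy_dominated)
    (metis minus_diff_minus order_refl rat_padic_abs_minus)

lemma padic_Cauchy_add:
  assumes p: "prime p" and X: "padic_Cauchy p X" and Y: "padic_Cauchy p Y"
  shows "padic_Cauchy p (\<lambda>n. X n + Y n)"
  unfolding padic_Cauchy_def
proof (intro allI impI)
  fix e :: real assume e: "e > 0"
  obtain M where M: "\<And>m n. m \<ge> M \<Longrightarrow> n \<ge> M \<Longrightarrow> rat_padic_abs p (X m - X n) < e / 2"
    using X e unfolding padic_Cauchy_def by (meson half_gt_zero)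
  obtain N where N: "\<And>m n. m \<ge> N \<Longrightarrow> n \<ge> N \<Longrightarrow> rat_padic_abs p (Y m - Y n) < e / 2"
    using Y e unfolding padic_Cauchy_def by (meson half_gt_zero)
  have "rat_padic_abs p (X m + Y m - (X n + Y n)) < e" if "m \<ge> max M N" "n \<ge> max M N" for m n
    using rat_padic_abs_add[OF p, of "X m - X n" "Y m - Y n"] M[of m n] N[of m n] that
    by (simp add: algebra_simps)
  then show "\<exists>N. \<forall>m\<ge>N. \<forall>n\<ge>N. rat_padic_abs p (X m + Y m - (X n + Y n)) < e" by blast
qed

lemma padic_Cauchy_abs_convergent:
  assumes p: "prime p" and X: "padic_Cauchy p X"
  shows "convergent (\<lambda>n. rat_padic_abs p (X n))"
proof -
  have "Cauchy (\<lambda>n. rat_padic_abs p (X n))"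
    unfolding Cauchy_def dist_real_def
    using X rat_padic_abs_triangle3[OF p] unfolding padic_Cauchy_def by (meson le_less_trans)
  then show ?thesis by (simp add: Cauchy_convergent)
qed

lemma padic_Cauchy_bounded:
  assumes "prime p" "padic_Cauchy p X"
  obtains K where "K > 0" "\<And>n. rat_padic_abs p (X n) \<le> K"
proof -
  have "Bseq (\<lambda>n. rat_padic_abs p (X n))"
    using padic_Cauchy_abs_convergent[OF assms] by (rule convergent_imp_Bseq)
  then show ?thesis using that by (auto simp: Bseq_def)
qed

lemma padic_Cauchy_mult:
  assumes p: "prime p" and X: "padic_Cauchy p X" and Y: "padic_Cauchy p Y"
  shows "padic_Cauchy p (\<lambda>n. X n * Y n)"
  unfolding padic_Cauchy_def
proof (intro allI impI)
  fix e :: real assume e: "e > 0"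
  obtain K where K: "K > 0" "\<And>n. rat_padic_abs p (X n) \<le> K"
    using padic_Cauchy_bounded[OF p X] by blast
  obtain L where L: "L > 0" "\<And>n. rat_padic_abs p (Y n) \<le> L"
    using padic_Cauchy_bounded[OF p Y] by blast
  obtain M where M: "\<And>m n. m \<ge> M \<Longrightarrow> n \<ge> M \<Longrightarrow> rat_padic_abs p (X m - X n) < e / (2 * L)"
    using X e L(1) unfolding padic_Cauchy_def by (meson divide_pos_pos mult_pos_pos zero_less_numeral)
  obtain N where N: "\<And>m n. m \<ge> N \<Longrightarrow> n \<ge> N \<Longrightarrow> rat_padic_abs p (Y m - Y n) < e / (2 * K)"
    using Y e K(1) unfolding padic_Cauchy_def by (meson divide_pos_pos mult_pos_pos zero_less_numeral)
  have "rat_padic_abs p (X m * Y m - X n * Y n) < e" if "m \<ge> max M N" "n \<ge> max M N" for m n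
  proof -
    have "X m * Y m - X n * Y n = X m * (Y m - Y n) + (X m - X n) * Y n"
      by (simp add: algebra_simps)
    then have "rat_padic_abs p (X m * Y m - X n * Y n)
        \<le> rat_padic_abs p (X m) * rat_padic_abs p (Y m - Y n)
          + rat_padic_abs p (X m - X n) * rat_padic_abs p (Y n)"
      using rat_padic_abs_add[OF p] by (metis rat_padic_abs_mult[OF p])
    also have "\<dots> \<le> K * rat_padic_abs p (Y m - Y n) + rat_padic_abs p (X m - X n) * L"
      using K L by (intro add_mono mult_mono) auto
    also have "\<dots> < K * (e / (2 * K)) + e / (2 * L) * L"
      using K(1) L(1) M[of m n] N[of m n] that
      by (intro add_strict_mono mult_strict_left_mono mult_strict_right_mono) auto
    also have "\<dots> = e" using K L by (simp add: field_simps)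
    finally show ?thesis .
  qed
  then show "\<exists>N. \<forall>m\<ge>N. \<forall>n\<ge>N. rat_padic_abs p (X m * Y m - X n * Y n) < e" by blast
qed

lemma padic_null_add:
  assumes "prime p" "padic_null p X" "padic_null p Y"
  shows "padic_null p (\<lambda>n. X n + Y n)"
  unfolding padic_null_def
proof (rule tendsto_sandwich[OF _ _ tendsto_const])
  show "(\<lambda>n. rat_padic_abs p (X n) + rat_padic_abs p (Y n)) \<longlonglongrightarrow> 0"
    using tendsto_add[OF assms(2,3)[unfolded padic_null_def]] by simp
qed (auto intro!: always_eventually rat_padic_abs_add assms)

lemma padic_null_minus: "prime p \<Longrightarrow> padic_null p X \<Longrightarrow> padic_null p (\<lambda>n. - X n)"
  by (simp add: padic_null_def)

lemma padic_null_mult_Cauchy: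
  assumes p: "prime p" and "padic_null p X" "padic_Cauchy p Y"
  shows "padic_null p (\<lambda>n. X n * Y n)"
proof -
  obtain L where "(\<lambda>n. rat_padic_abs p (Y n)) \<longlonglongrightarrow> L"
    using padic_Cauchy_abs_convergent[OF p assms(3)] by (auto simp: convergent_def)
  from tendsto_mult[OF assms(2)[unfolded padic_null_def] this]
  show ?thesis by (simp add: padic_null_def rat_padic_abs_mult[OF p])
qed

lemma padic_Cauchy_not_null:
  assumes p: "prime p" and X: "padic_Cauchy p X" and "\<not> padic_null p X"
  obtains L where "L > 0" "(\<lambda>n. rat_padic_abs p (X n)) \<longlonglongrightarrow> L"
proof -
  obtain L where L: "(\<lambda>n. rat_padic_abs p (X n)) \<longlonglongrightarrow> L"
    using padic_Cauchy_abs_convergent[OF p X] by (auto simp: convergent_def)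
  moreover have "L \<ge> 0" using L by (rule LIMSEQ_le_const) auto
  moreover have "L \<noteq> 0" using L assms(3) by (auto simp: padic_null_def)
  ultimately show ?thesis using that[of L] by simp
qed

lemma rat_padic_abs_inverse_diff:
  assumes "prime p" "x \<noteq> 0" "y \<noteq> 0"
  shows "rat_padic_abs p (inverse x - inverse y)
    = rat_padic_abs p (x - y) / (rat_padic_abs p x * rat_padic_abs p y)"
proof -
  have "inverse x - inverse y = (y - x) * inverse (x * y)"
    using assms by (simp add: field_simps)
  then show ?thesis
    using assms(1) rat_padic_abs_minus_commute[of p x y]
    by (simp only: rat_padic_abs_mult rat_padic_abs_inverse divide_inverse)
qed

lemma padic_Cauchy_inverse:
  assumes p: "prime p" and X: "padic_Cauchy p X" and nn: "\<not> padic_null p X"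
  shows "padic_Cauchy p (\<lambda>n. inverse (X n))"
  unfolding padic_Cauchy_def
proof (intro allI impI)
  fix e :: real assume e: "e > 0"
  obtain L where L: "L > 0" "(\<lambda>n. rat_padic_abs p (X n)) \<longlonglongrightarrow> L"
    using padic_Cauchy_not_null[OF assms] by blast
  have "eventually (\<lambda>n. rat_padic_abs p (X n) > L / 2) sequentially"
    using L by (intro order_tendstoD(1)[OF L(2)]) simp
  then obtain M where M: "\<And>n. n \<ge> M \<Longrightarrow> rat_padic_abs p (X n) > L / 2"
    by (auto simp: eventually_sequentially)
  have "e * (L / 2 * (L / 2)) > 0" using e L by simp
  then obtain N where N: "\<And>m n. m \<ge> N \<Longrightarrow> n \<ge> N \<Longrightarrow>
      rat_padic_abs p (X m - X n) < e * (L / 2 * (L / 2))"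
    using X unfolding padic_Cauchy_def by meson
  have "rat_padic_abs p (inverse (X m) - inverse (X n)) < e" if "m \<ge> max M N" "n \<ge> max M N" for m n
  proof -
    have g: "rat_padic_abs p (X m) > L / 2" "rat_padic_abs p (X n) > L / 2" using M that by auto
    then have nz: "X m \<noteq> 0" "X n \<noteq> 0" using L(1) by auto
    have "L / 2 * (L / 2) \<le> rat_padic_abs p (X m) * rat_padic_abs p (X n)"
      using g L(1) by (intro mult_mono) auto
    then have "e * (L / 2 * (L / 2)) \<le> e * (rat_padic_abs p (X m) * rat_padic_abs p (X n))"
      using e by (intro mult_left_mono) auto
    then have "rat_padic_abs p (X m - X n) < e * (rat_padic_abs p (X m) * rat_padic_abs p (X n))"
      using N[of m n] that by simp
    moreover have "rat_padic_abs p (X m) * rat_padic_abs p (X n) > 0"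
      using nz p by (simp add: order_less_le)
    ultimately show ?thesis
      using nz p by (simp add: rat_padic_abs_inverse_diff pos_divide_less_eq)
  qed
  then show "\<exists>N. \<forall>m\<ge>N. \<forall>n\<ge>N. rat_padic_abs p (inverse (X m) - inverse (X n)) < e" by blast
qed

lemma padic_null_rel:
  assumes "padic_rel p X Y" "prime p" shows "padic_null p X \<longleftrightarrow> padic_null p Y"
  using padic_null_add[OF assms(2), of "\<lambda>n. X n - Y n" Y]
    padic_null_add[OF assms(2), of "\<lambda>n. - (X n - Y n)" X]
    padic_null_minus[OF assms(2), of "\<lambda>n. X n - Y n"] assms(1)
  by (auto simp: padic_rel_def)

lemma padic_rel_inverse:
  assumes p: "prime p" and XY: "padic_rel p X Y"
    and nX: "\<not> padic_null p X"
  shows "padic_rel p (\<lambda>n. inverse (X n)) (\<lambda>n. inverse (Y n))"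
proof -
  have cX: "padic_Cauchy p X" and cY: "padic_Cauchy p Y" and d: "padic_null p (\<lambda>n. X n - Y n)"
    using XY by (auto simp: padic_rel_def)
  have nY: "\<not> padic_null p Y" using nX padic_null_rel[OF XY p] by simp
  obtain L where L: "L > 0" "(\<lambda>n. rat_padic_abs p (X n)) \<longlonglongrightarrow> L"
    using padic_Cauchy_not_null[OF p cX nX] by blast
  obtain K where K: "K > 0" "(\<lambda>n. rat_padic_abs p (Y n)) \<longlonglongrightarrow> K"
    using padic_Cauchy_not_null[OF p cY nY] by blast
  have lim: "(\<lambda>n. rat_padic_abs p (X n - Y n) / (rat_padic_abs p (X n) * rat_padic_abs p (Y n)))
      \<longlonglongrightarrow> 0 / (L * K)"
    using L K d[unfolded padic_null_def] by (intro tendsto_intros) auto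
  have ev: "eventually (\<lambda>n. rat_padic_abs p (X n - Y n) / (rat_padic_abs p (X n) * rat_padic_abs p (Y n))
      = rat_padic_abs p (inverse (X n) - inverse (Y n))) sequentially"
    using order_tendstoD(1)[OF L(2) L(1)] order_tendstoD(1)[OF K(2) K(1)]
    by eventually_elim (subst rat_padic_abs_inverse_diff[OF p], auto)
  have "padic_null p (\<lambda>n. inverse (X n) - inverse (Y n))"
    using Lim_transform_eventually[OF lim ev] by (simp add: padic_null_def)
  then show ?thesis
    using padic_Cauchy_inverse[OF p cX nX] padic_Cauchy_inverse[OF p cY nY]
    by (simp add: padic_rel_def)
qed

text \<open>
  The prime is carried by the index type: \<open>'p padic\<close> is the field of \<open>p\<close>-adic numbers for
  \<open>p = CARD('p)\<close>. Every prime is the cardinality of some type of class \<open>prime_card\<close>.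
\<close>

lemma padic_rel_part_equivp: "part_equivp (padic_rel CARD('p::prime_card))"
proof (rule part_equivpI)
  have p: "prime CARD('p)" by (rule prime_card)
  show "\<exists>X. padic_rel CARD('p) X X"
    by (intro exI[of _ "\<lambda>_. 0"]) (simp add: padic_rel_def padic_null_def)
  show "symp (padic_rel CARD('p))"
    by (rule sympI) (auto simp: padic_rel_def padic_null_def rat_padic_abs_minus_commute[OF p])
  show "transp (padic_rel CARD('p))"
  proof (rule transpI)
    fix X Y Z assume "padic_rel CARD('p) X Y" "padic_rel CARD('p) Y Z"
    then show "padic_rel CARD('p) X Z"
      using padic_null_add[OF p, of "\<lambda>n. X n - Y n" "\<lambda>n. Y n - Z n"] by (auto simp: padic_rel_def)
  qed
qed

typedef (overloaded) ('p::prime_card) padic =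
  "{c. \<exists>X. padic_rel CARD('p) X X \<and> c = Collect (padic_rel CARD('p) X)}"
  using padic_rel_part_equivp by (auto simp: part_equivp_def)

interpretation padic: quot_type "padic_rel CARD('p::prime_card)"
  "Abs_padic :: _ \<Rightarrow> 'p padic" Rep_padic
  using Rep_padic Abs_padic_inverse
  by (intro quot_type.intro)
    (auto simp: padic_rel_part_equivp Rep_padic_inverse Rep_padic_inject)

definition padic_of_seq :: "(nat \<Rightarrow> rat) \<Rightarrow> 'p::prime_card padic" where
  "padic_of_seq = padic.abs"

definition seq_of_padic :: "'p::prime_card padic \<Rightarrow> nat \<Rightarrow> rat" where
  "seq_of_padic = padic.rep"

definition cr_padic :: "(nat \<Rightarrow> rat) \<Rightarrow> 'p::prime_card padic \<Rightarrow> bool" where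
  "cr_padic X x \<longleftrightarrow> padic_rel CARD('p) X X \<and> padic_of_seq X = x"

lemma Quotient_padic:
  "Quotient (padic_rel CARD('p::prime_card)) (padic_of_seq :: _ \<Rightarrow> 'p padic) seq_of_padic cr_padic"
  by (rule Quotient3_to_Quotient)
    (simp_all add: padic_of_seq_def seq_of_padic_def padic.Quotient cr_padic_def[abs_def])

setup_lifting Quotient_padic

instantiation padic :: (prime_card) field
begin

lift_definition zero_padic :: "'a padic" is "\<lambda>n. 0"
  by (simp add: padic_rel_def padic_null_def)

lift_definition one_padic :: "'a padic" is "\<lambda>n. 1"
  by (simp add: padic_rel_def padic_null_def)

lift_definition plus_padic :: "'a padic \<Rightarrow> 'a padic \<Rightarrow> 'a padic" is "\<lambda>X Y n. X n + Y n"
proof -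
  fix X X' Y Y' assume "padic_rel CARD('a) X X'" "padic_rel CARD('a) Y Y'"
  then show "padic_rel CARD('a) (\<lambda>n. X n + Y n) (\<lambda>n. X' n + Y' n)"
    using padic_null_add[OF prime_card, of "\<lambda>n. X n - X' n" "\<lambda>n. Y n - Y' n"]
    by (auto simp: padic_rel_def padic_Cauchy_add prime_card algebra_simps)
qed

lift_definition uminus_padic :: "'a padic \<Rightarrow> 'a padic" is "\<lambda>X n. - X n"
proof -
  fix X Y assume "padic_rel CARD('a) X Y"
  then show "padic_rel CARD('a) (\<lambda>n. - X n) (\<lambda>n. - Y n)"
    using padic_null_minus[OF prime_card, of "\<lambda>n. X n - Y n"]
    by (auto simp: padic_rel_def padic_Cauchy_minus prime_card algebra_simps)
qed

lift_definition times_padic :: "'a padic \<Rightarrow> 'a padic \<Rightarrow> 'a padic" is "\<lambda>X Y n. X n * Y n"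
proof -
  fix X X' Y Y' assume *: "padic_rel CARD('a) X X'" "padic_rel CARD('a) Y Y'"
  have "padic_null CARD('a) (\<lambda>n. (X n - X' n) * Y n + (Y n - Y' n) * X' n)"
    using * by (intro padic_null_add padic_null_mult_Cauchy prime_card) (auto simp: padic_rel_def)
  then show "padic_rel CARD('a) (\<lambda>n. X n * Y n) (\<lambda>n. X' n * Y' n)"
    using * by (auto simp: padic_rel_def padic_Cauchy_mult prime_card algebra_simps)
qed

lift_definition inverse_padic :: "'a padic \<Rightarrow> 'a padic"
  is "\<lambda>X. if padic_null CARD('a) X then (\<lambda>n. 0) else (\<lambda>n. inverse (X n))"
proof -
  fix X Y assume *: "padic_rel CARD('a) X Y"
  show "padic_rel CARD('a) (if padic_null CARD('a) X then \<lambda>n. 0 else (\<lambda>n. inverse (X n)))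
     (if padic_null CARD('a) Y then \<lambda>n. 0 else (\<lambda>n. inverse (Y n)))"
    using padic_rel_inverse[OF prime_card *] padic_null_rel[OF * prime_card]
    by (auto simp: padic_rel_def padic_null_def)
qed

definition minus_padic :: "'a padic \<Rightarrow> 'a padic \<Rightarrow> 'a padic" where
  "minus_padic x y = x + - y"

definition divide_padic :: "'a padic \<Rightarrow> 'a padic \<Rightarrow> 'a padic" where
  "divide_padic x y = x * inverse y"

instance
proof
  fix a b c :: "'a padic"
  have p: "prime CARD('a)" by (rule prime_card)
  note cl = padic_Cauchy_add[OF p] padic_Cauchy_mult[OF p] padic_Cauchy_minus[OF p]
  show "a + b + c = a + (b + c)"
    by transfer (simp add: padic_rel_def padic_null_def cl algebra_simps)
  show "a + b = b + a"
    by transfer (simp add: padic_rel_def padic_null_def cl algebra_simps)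
  show "0 + a = a"
    by transfer (simp add: padic_rel_def padic_null_def cl)
  show "- a + a = 0"
    by transfer (simp add: padic_rel_def padic_null_def cl)
  show "a - b = a + - b"
    by (simp add: minus_padic_def)
  show "a * b * c = a * (b * c)"
    by transfer (simp add: padic_rel_def padic_null_def cl algebra_simps)
  show "a * b = b * a"
    by transfer (simp add: padic_rel_def padic_null_def cl algebra_simps)
  show "1 * a = a"
    by transfer (simp add: padic_rel_def padic_null_def cl)
  show "(a + b) * c = a * c + b * c"
    by transfer (simp add: padic_rel_def padic_null_def cl algebra_simps)
  show "(0 :: 'a padic) \<noteq> 1"
    by transfer (simp add: padic_rel_def padic_null_def p LIMSEQ_const_iff)
  show "a div b = a * inverse b"
    by (simp add: divide_padic_def)
  show "inverse (0 :: 'a padic) = 0"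
    by transfer (simp add: padic_rel_def padic_null_def)
  show "a \<noteq> 0 \<Longrightarrow> inverse a * a = 1"
  proof transfer
    fix X assume X: "padic_rel CARD('a) X X" and "\<not> padic_rel CARD('a) X (\<lambda>n. 0)"
    then have nX: "\<not> padic_null CARD('a) X" and cX: "padic_Cauchy CARD('a) X"
      by (auto simp: padic_rel_def)
    obtain L where L: "L > 0" "(\<lambda>n. rat_padic_abs CARD('a) (X n)) \<longlonglongrightarrow> L"
      using padic_Cauchy_not_null[OF p cX nX] by blast
    have "eventually (\<lambda>n. rat_padic_abs CARD('a) (inverse (X n) * X n - 1) = 0) sequentially"
      using order_tendstoD(1)[OF L(2) L(1)]
    proof eventually_elim
      case (elim n)
      then have "X n \<noteq> 0" by auto
      then show ?case by simp
    qed
    then have "padic_null CARD('a) (\<lambda>n. inverse (X n) * X n - 1)"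
      unfolding padic_null_def by (rule tendsto_eventually)
    then show "padic_rel CARD('a)
        (\<lambda>n. (if padic_null CARD('a) X then \<lambda>n. 0 else (\<lambda>n. inverse (X n))) n * X n) (\<lambda>n. 1)"
      using nX cX by (simp add: padic_rel_def padic_Cauchy_mult[OF p] padic_Cauchy_inverse[OF p])
  qed
qed

end

lift_definition padic_abs :: "'p::prime_card padic \<Rightarrow> real"
  is "\<lambda>X. lim (\<lambda>n. rat_padic_abs CARD('p) (X n))"
proof -
  fix X Y assume *: "padic_rel CARD('p) X Y"
  have p: "prime CARD('p)" by (rule prime_card)
  obtain L where L: "(\<lambda>n. rat_padic_abs CARD('p) (X n)) \<longlonglongrightarrow> L"
    using * padic_Cauchy_abs_convergent[OF p] by (auto simp: padic_rel_def convergent_def)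
  have "(\<lambda>n. rat_padic_abs CARD('p) (Y n) - rat_padic_abs CARD('p) (X n)) \<longlonglongrightarrow> 0"
  proof (rule tendsto_rabs_zero_cancel, rule tendsto_sandwich[OF _ _ tendsto_const])
    show "(\<lambda>n. rat_padic_abs CARD('p) (X n - Y n)) \<longlonglongrightarrow> 0"
      using * by (simp add: padic_rel_def padic_null_def)
  qed (auto intro!: always_eventually simp: rat_padic_abs_minus_commute[OF p, of "X _"]
        rat_padic_abs_triangle3[OF p])
  from tendsto_add[OF this L] have "(\<lambda>n. rat_padic_abs CARD('p) (Y n)) \<longlonglongrightarrow> L" by simp
  with L show "lim (\<lambda>n. rat_padic_abs CARD('p) (X n)) = lim (\<lambda>n. rat_padic_abs CARD('p) (Y n))"
    by (simp add: limI)
qed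

lemma padic_abs_raw_LIMSEQ:
  assumes "padic_rel CARD('p::prime_card) X X"
  shows "(\<lambda>n. rat_padic_abs CARD('p) (X n)) \<longlonglongrightarrow> lim (\<lambda>n. rat_padic_abs CARD('p) (X n))"
  using padic_Cauchy_abs_convergent[OF prime_card[where 'a='p], of X] assms
  by (simp add: padic_rel_def convergent_LIMSEQ_iff)

lemma padic_abs_nonneg [simp]: "padic_abs x \<ge> 0"
proof transfer
  fix X assume "padic_rel CARD('a) X X"
  from padic_abs_raw_LIMSEQ[OF this] show "0 \<le> lim (\<lambda>n. rat_padic_abs CARD('a) (X n))"
    by (rule LIMSEQ_le_const) auto
qed

lemma padic_abs_eq_0_iff [simp]: "padic_abs x = 0 \<longleftrightarrow> x = 0"
proof transfer
  fix X assume X: "padic_rel CARD('a) X X"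
  show "lim (\<lambda>n. rat_padic_abs CARD('a) (X n)) = 0 \<longleftrightarrow> padic_rel CARD('a) X (\<lambda>n. 0)"
    (is "?L = 0 \<longleftrightarrow> _")
  proof
    assume "?L = 0"
    then show "padic_rel CARD('a) X (\<lambda>n. 0)"
      using padic_abs_raw_LIMSEQ[OF X] X by (simp add: padic_rel_def padic_null_def)
  next
    assume "padic_rel CARD('a) X (\<lambda>n. 0)"
    then have "(\<lambda>n. rat_padic_abs CARD('a) (X n)) \<longlonglongrightarrow> 0"
      by (simp add: padic_rel_def padic_null_def)
    then show "?L = 0" by (rule limI)
  qed
qed

lemma padic_abs_mult: "padic_abs (x * y) = padic_abs x * padic_abs y"
proof transfer
  fix X Y assume "padic_rel CARD('a) X X" "padic_rel CARD('a) Y Y"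
  from tendsto_mult[OF this[THEN padic_abs_raw_LIMSEQ]]
  show "lim (\<lambda>n. rat_padic_abs CARD('a) (X n * Y n))
      = lim (\<lambda>n. rat_padic_abs CARD('a) (X n)) * lim (\<lambda>n. rat_padic_abs CARD('a) (Y n))"
    by (simp add: rat_padic_abs_mult prime_card limI)
qed

lemma padic_abs_add_max: "padic_abs (x + y) \<le> max (padic_abs x) (padic_abs y)"
proof transfer
  fix X Y assume *: "padic_rel CARD('a) X X" "padic_rel CARD('a) Y Y"
  then have "padic_rel CARD('a) (\<lambda>n. X n + Y n) (\<lambda>n. X n + Y n)"
    by (auto simp: padic_rel_def padic_null_def padic_Cauchy_add prime_card)
  from padic_abs_raw_LIMSEQ[OF this] tendsto_max[OF *[THEN padic_abs_raw_LIMSEQ]]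
  show "lim (\<lambda>n. rat_padic_abs CARD('a) (X n + Y n))
      \<le> max (lim (\<lambda>n. rat_padic_abs CARD('a) (X n))) (lim (\<lambda>n. rat_padic_abs CARD('a) (Y n)))"
    by (rule LIMSEQ_le) (auto simp: rat_padic_abs_add_max prime_card)
qed

lemma padic_abs_minus [simp]: "padic_abs (- x) = padic_abs x"
  by transfer (simp add: prime_card)

lemma padic_abs_minus_commute: "padic_abs (x - y) = padic_abs (y - x)"
  using padic_abs_minus[of "x - y"] by simp

lemma padic_of_nat: "(of_nat n :: 'p::prime_card padic) = padic_of_seq (\<lambda>_. of_nat n)"
proof (induction n)
  case 0
  show ?case by (simp add: zero_padic_def)
next
  case (Suc n)
  have "padic_rel CARD('p) (\<lambda>_. c) (\<lambda>_. c)" for c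
    by (simp add: padic_rel_def padic_null_def)
  then show ?case
    using Suc by (simp add: one_padic_def plus_padic.abs_eq)
qed

lemma padic_abs_of_nat:
  "padic_abs (of_nat n :: 'p::prime_card padic) = rat_padic_abs CARD('p) (of_nat n)"
  by (simp add: padic_of_nat padic_abs.abs_eq padic_rel_def padic_null_def)

instantiation padic :: (prime_card) metric_space
begin

definition dist_padic :: "'a padic \<Rightarrow> 'a padic \<Rightarrow> real" where
  "dist_padic x y = padic_abs (x - y)"

definition uniformity_padic :: "('a padic \<times> 'a padic) filter" where
  "uniformity_padic = (INF e\<in>{0<..}. principal {(x, y). dist x y < e})"

definition open_padic :: "'a padic set \<Rightarrow> bool" where
  "open_padic U \<longleftrightarrow> (\<forall>x\<in>U. eventually (\<lambda>(x', y). x' = x \<longrightarrow> y \<in> U) uniformity)"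

instance
proof
  fix x y z :: "'a padic"
  show "dist x y = 0 \<longleftrightarrow> x = y" by (simp add: dist_padic_def)
  have "padic_abs (x - y) \<le> max (padic_abs (x - z)) (padic_abs (y - z))"
    using padic_abs_add_max[of "x - z" "z - y"] by (simp add: padic_abs_minus_commute[of z])
  then show "dist x y \<le> dist x z + dist y z"
    using padic_abs_nonneg[of "x - z"] padic_abs_nonneg[of "y - z"]
    by (simp add: dist_padic_def max_def del: padic_abs_nonneg split: if_splits)
qed (simp_all only: uniformity_padic_def open_padic_def)

end


section \<open>Haar measure, balls, and local integrability\<close>

text \<open>
  Left translation by \<open>c\<close> is a homeomorphism, so translates of Borel sets are Borel. Finiteness on
  compact sets follows from the normalization.
\<close>

definition normalized_haar :: "'p::prime_card padic measure \<Rightarrow> bool" where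
  "normalized_haar \<mu> \<longleftrightarrow>
     sets \<mu> = sets borel \<and>
     (\<forall>c. \<forall>A\<in>sets borel. emeasure \<mu> ((\<lambda>x. c + x) ` A) = emeasure \<mu> A) \<and>
     emeasure \<mu> {x. padic_abs x \<le> 1} = 1"

definition padic_ball :: "int \<Rightarrow> 'p::prime_card padic \<Rightarrow> 'p padic set" where
  "padic_ball l a = {x. padic_abs (x - a) \<le> real CARD('p) powi l}"

text \<open>
  Measurability is required separately: a set integral over a compact set only tests \<open>f\<close> there.
\<close>

definition locally_integrable :: "'p::prime_card padic measure \<Rightarrow> ('p padic \<Rightarrow> complex) \<Rightarrow> bool" where
  "locally_integrable \<mu> f \<longleftrightarrow>
     f \<in> borel_measurable \<mu> \<and> (\<forall>K. compact K \<longrightarrow> set_integrable \<mu> K f)"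


section \<open>Fractional Cesaro--Morrey spaces\<close>

text \<open>\<open>x\<^sup>r\<close> for \<open>x \<in> [0, \<infinity>]\<close>; used for \<open>r > 0\<close> only, where \<open>\<infinity>\<^sup>r = \<infinity>\<close>.\<close>

definition ennreal_powr :: "ennreal \<Rightarrow> real \<Rightarrow> ennreal" where
  "ennreal_powr x r = (if x = \<infinity> then \<infinity> else ennreal (enn2real x powr r))"

text \<open>
  The norm takes values in \<open>[0, \<infinity>]\<close>. At \<open>x = 0\<close>, a null set, the factor \<open>1 / 0\<close> is read as \<open>0\<close>.
\<close>

definition cesaro_morrey_norm ::
  "'p::prime_card padic measure \<Rightarrow> real \<Rightarrow> real \<Rightarrow> real \<Rightarrow> ('p padic \<Rightarrow> complex) \<Rightarrow> ennreal" where
  "cesaro_morrey_norm \<mu> \<beta> r q f =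
     (SUP (a, l) \<in> UNIV \<times> UNIV.
        ennreal (measure \<mu> (padic_ball l a) powr (1 / q - 1 / r)) *
        ennreal_powr
          (\<integral>\<^sup>+ x \<in> padic_ball l a.
             ennreal_powr
               (ennreal (1 / padic_abs x powr (1 - \<beta>)) *
                (\<integral>\<^sup>+ t \<in> {t. padic_abs t \<le> padic_abs x}. ennreal (cmod (f t)) \<partial>\<mu>))
               r \<partial>\<mu>)
          (1 / r))"

definition cesaro_morrey ::
  "'p::prime_card padic measure \<Rightarrow> real \<Rightarrow> real \<Rightarrow> real \<Rightarrow> ('p padic \<Rightarrow> complex) set" where
  "cesaro_morrey \<mu> \<beta> r q = {f. locally_integrable \<mu> f \<and> cesaro_morrey_norm \<mu> \<beta> r q f < \<infinity>}"


section \<open>Erdelyi--Kober fractional integrals\<close>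

text \<open>
  Both operators are defined on nonzero arguments \<open>s\<close>; their values at the null set \<open>{0}\<close> are
  irrelevant. The integrands are named separately so that absolute convergence of the integrals
  can be expressed: a Bochner integral is \<open>0\<close> when its integrand is not integrable.
\<close>

definition EK1_integrand ::
  "real \<Rightarrow> real \<Rightarrow> real \<Rightarrow> ('p::prime_card padic \<Rightarrow> complex) \<Rightarrow> 'p padic \<Rightarrow> 'p padic \<Rightarrow> complex" where
  "EK1_integrand \<nu> \<gamma> \<delta> f s t =
     complex_of_real (padic_abs t powr (\<nu> * (\<gamma> + 1) - 1) *
       (padic_abs s powr \<nu> - padic_abs t powr \<nu>) powr (\<delta> - 1)) * f t"

definition EK1_domain :: "'p::prime_card padic \<Rightarrow> 'p padic set" where
  "EK1_domain s = {t. t \<noteq> 0 \<and> padic_abs t < padic_abs s}"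

definition EK1 ::
  "'p::prime_card padic measure \<Rightarrow> real \<Rightarrow> real \<Rightarrow> real \<Rightarrow> ('p padic \<Rightarrow> complex) \<Rightarrow> 'p padic \<Rightarrow> complex" where
  "EK1 \<mu> \<nu> \<gamma> \<delta> f s =
     complex_of_real (padic_abs s powr (- \<nu> * (\<gamma> + \<delta>)) / Gamma \<delta>) *
     (LINT t:EK1_domain s|\<mu>. EK1_integrand \<nu> \<gamma> \<delta> f s t)"

definition EK2_integrand ::
  "real \<Rightarrow> real \<Rightarrow> real \<Rightarrow> ('p::prime_card padic \<Rightarrow> complex) \<Rightarrow> 'p padic \<Rightarrow> 'p padic \<Rightarrow> complex" where
  "EK2_integrand \<nu> \<gamma> \<delta> f s t =
     complex_of_real (padic_abs t powr (- \<nu> * (\<gamma> + \<delta>) + \<nu> - 1) *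
       (padic_abs t powr \<nu> - padic_abs s powr \<nu>) powr (\<delta> - 1)) * f t"

definition EK2_domain :: "'p::prime_card padic \<Rightarrow> 'p padic set" where
  "EK2_domain s = {t. t \<noteq> 0 \<and> padic_abs t > padic_abs s}"

definition EK2 ::
  "'p::prime_card padic measure \<Rightarrow> real \<Rightarrow> real \<Rightarrow> real \<Rightarrow> ('p padic \<Rightarrow> complex) \<Rightarrow> 'p padic \<Rightarrow> complex" where
  "EK2 \<mu> \<nu> \<gamma> \<delta> f s =
     complex_of_real (padic_abs s powr (\<nu> * \<gamma>) / Gamma \<delta>) *
     (LINT t:EK2_domain s|\<mu>. EK2_integrand \<nu> \<gamma> \<delta> f s t)"

end

theory Submission
  imports Defs
begin

text \<open>
  Write \<open>p\<close> for the prime. The absolute value takes only the values \<open>0\<close> and \<open>p^k\<close>, so everything can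
  be read off from the spheres \<open>\<bar>x\<bar> = p^k\<close>. The Cesaro average of \<open>f\<close> is constant on each of them,
  with value \<open>W f k = p^((\<beta> - 1) k) A f k\<close>, where \<open>A f k\<close> is the integral of \<open>\<bar>f\<bar>\<close> over the ball of
  radius \<open>p^k\<close> around \<open>0\<close>. The norm of \<open>f\<close> is the Morrey norm of this radial function, and
  replacing the sequence \<open>W f k\<close> by \<open>W f (k + s)\<close> is a dilation, which multiplies the Morrey norm by
  \<open>p^(- s / q)\<close> (\<open>nn_integral_radial_shift\<close>).

  Both kernels are constant on spheres, and the singular factor is harmless: if \<open>\<bar>t\<bar> < \<bar>s\<bar>\<close>, then
  \<open>\<bar>t\<bar> \<le> \<bar>s\<bar> / p\<close>, hence \<open>\<bar>s\<bar>^\<nu> - \<bar>t\<bar>^\<nu>\<close> is comparable to \<open>\<bar>s\<bar>^\<nu>\<close> (\<open>powr_gap_le\<close>). Therefore both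
  operators are bounded on the sphere of level \<open>k\<close> by a series over \<open>n\<close> of \<open>c n\<close> times the average of
  \<open>\<bar>f\<bar>\<close> over the sphere of level \<open>k + sh n\<close>. For the first kind \<open>sh n = - (n + 1)\<close> and \<open>c n\<close> is a
  constant times \<open>p^(- (n + 1) \<nu> (\<gamma> + 1))\<close>; for the second kind \<open>sh n = n + 1\<close> and \<open>c n\<close> is a constant
  times \<open>p^(- (n + 1) \<nu> \<gamma>)\<close>.

  Integrated over balls, this bound says that the Cesaro averages of the image are at most the series
  of \<open>c n p^(- \<beta> sh n) W f (k + sh n)\<close> (\<open>cesaro_level_le_of_sphere_averages\<close>). Each shift contributes a
  further factor \<open>p^(- sh n / q)\<close> to the norm, and summing with Jensen's inequality
  (\<open>morrey_bound_shift_sum\<close>) gives the theorem with the constant \<open>C\<close> equal to the sum of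
  \<open>c n p^(- sh n (\<beta> + 1 / q))\<close>. This is a geometric series. Its ratio is
  \<open>p^(\<beta> + 1 / q - \<nu> (\<gamma> + 1))\<close> for the first kind and \<open>p^(- (\<nu> \<gamma> + \<beta> + 1 / q))\<close> for the second, and the
  two hypotheses say that these ratios are smaller than \<open>1\<close>.

  The same estimate shows that the integrals converge absolutely, since a radial function of finite
  Morrey norm is finite off the origin (\<open>morrey_bound_finite\<close>).
\<close>

section \<open>Value group and residue field\<close>

lemma padic_abs_const: "padic_abs (padic_of_seq (\<lambda>_. c) :: 'p::prime_card padic) = rat_padic_abs CARD('p) c"
  by (simp add: padic_abs.abs_eq padic_rel_def padic_null_def)

lemma padic_const_diff:
  "(padic_of_seq (\<lambda>_. b) - padic_of_seq (\<lambda>_. c) :: 'p::prime_card padic) = padic_of_seq (\<lambda>_. b - c)"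
  by (simp add: minus_padic_def uminus_padic.abs_eq plus_padic.abs_eq padic_rel_def padic_null_def)

text \<open>
  The terms of a Cauchy sequence of rationals approximate the \<open>p\<close>-adic number that it represents.
\<close>

lemma padic_rat_dense:
  fixes x :: "'p::prime_card padic"
  assumes "e > 0"
  obtains c where "padic_abs (x - padic_of_seq (\<lambda>_. c)) < e"
proof -
  have p: "prime CARD('p)" by (rule prime_card)
  define X where "X = seq_of_padic x"
  have X: "padic_rel CARD('p) X X" "x = padic_of_seq X"
    using Quotient_rep_reflp[OF Quotient_padic] Quotient_abs_rep[OF Quotient_padic]
    unfolding X_def by metis+
  have C: "padic_Cauchy CARD('p) X" using X by (simp add: padic_rel_def)
  then obtain N where N: "\<And>m n. m \<ge> N \<Longrightarrow> n \<ge> N \<Longrightarrow> rat_padic_abs CARD('p) (X m - X n) < e/2"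
    using assms unfolding padic_Cauchy_def by (meson half_gt_zero)
  define Y where "Y = (\<lambda>n. X n + - X N)"
  have Y: "padic_rel CARD('p) Y Y"
    using padic_Cauchy_add[OF p C padic_Cauchy_const, of "- X N"] unfolding Y_def
    by (simp add: padic_rel_def padic_null_def)
  have "x - padic_of_seq (\<lambda>_. X N) = padic_of_seq Y"
    using X by (simp add: minus_padic_def uminus_padic.abs_eq plus_padic.abs_eq padic_rel_def padic_null_def Y_def)
  then have eq: "padic_abs (x - padic_of_seq (\<lambda>_. X N)) = lim (\<lambda>n. rat_padic_abs CARD('p) (Y n))"
    using Y by (simp add: padic_abs.abs_eq)
  have "(\<lambda>n. rat_padic_abs CARD('p) (Y n)) \<longlonglongrightarrow> padic_abs (x - padic_of_seq (\<lambda>_. X N))"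
    using padic_abs_raw_LIMSEQ[OF Y] eq by simp
  then have "padic_abs (x - padic_of_seq (\<lambda>_. X N)) \<le> e/2"
    by (rule LIMSEQ_le_const2) (use N in \<open>force simp: Y_def intro: less_imp_le\<close>)
  then show ?thesis using that[of "X N"] assms by linarith
qed

lemma padic_abs_add_eq:
  fixes x y :: "'p::prime_card padic"
  assumes "padic_abs y < padic_abs x"
  shows "padic_abs (x + y) = padic_abs x"
  using padic_abs_add_max[of x y] padic_abs_add_max[of "x + y" "- y"] assms by (auto simp: max_def split: if_splits)

lemma padic_base_gt_1: "real CARD('p::prime_card) > 1"
  using prime_gt_1_nat[OF prime_card[where 'a='p]] by simp

text \<open>
  A rational number closer to \<open>x\<close> than \<open>\<bar>x\<bar>\<close> has the same absolute value as \<open>x\<close>, by the ultrametric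
  inequality. So the completion takes no new values.
\<close>

lemma padic_value_group:
  fixes x :: "'p::prime_card padic"
  assumes "x \<noteq> 0"
  obtains k :: int where "padic_abs x = real CARD('p) powi k"
proof -
  have "padic_abs x > 0" using assms by (simp add: order_less_le)
  then obtain c where c: "padic_abs (x - padic_of_seq (\<lambda>_. c)) < padic_abs x"
    using padic_rat_dense by metis
  have "padic_abs (x + (padic_of_seq (\<lambda>_. c) - x)) = padic_abs x"
    using c by (intro padic_abs_add_eq) (simp add: padic_abs_minus_commute)
  then have "rat_padic_abs CARD('p) c = padic_abs x" by (simp add: padic_abs_const)
  moreover from this have "c \<noteq> 0" using assms by auto
  ultimately show ?thesis using that[of "- rat_padic_val CARD('p) c"] by (simp add: rat_padic_abs_def)
qed

lemma padic_abs_card: "padic_abs (of_nat CARD('p) :: 'p::prime_card padic) = 1 / real CARD('p)"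
proof -
  have "multiplicity (int CARD('p)) (int CARD('p)) = 1"
    using prime_gt_1_nat[OF prime_card[where 'a='p]] by (intro multiplicity_self) auto
  moreover have "quotient_of (rat_of_nat CARD('p)) = (int CARD('p), 1)"
    using quotient_of_int[of "int CARD('p)"] by (simp add: of_int_of_nat_eq)
  ultimately show ?thesis
    by (simp add: padic_abs_of_nat rat_padic_abs_def rat_padic_val_def power_int_minus field_simps)
qed

lemma padic_abs_of_nat_small:
  assumes "0 < n" "n < CARD('p)"
  shows "padic_abs (of_nat n :: 'p::prime_card padic) = 1"
proof -
  have "\<not> int CARD('p) dvd int n" using assms by (auto dest: dvd_imp_le)
  then have "multiplicity (int CARD('p)) (int n) = 0" by (rule not_dvd_imp_multiplicity_0)
  moreover have "quotient_of (rat_of_nat n) = (int n, 1)"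
    using quotient_of_int[of "int n"] by simp
  ultimately show ?thesis using assms
    by (simp add: padic_abs_of_nat rat_padic_abs_def rat_padic_val_def)
qed

text \<open>
  If a reduced fraction \<open>a / b\<close> approximates \<open>x\<close> to within less than \<open>1\<close>, then \<open>p\<close> does not divide
  \<open>b\<close>. With \<open>u\<close> an inverse of \<open>b\<close> modulo \<open>p\<close>, the residue of \<open>x\<close> is that of \<open>u * a\<close>.
\<close>

lemma padic_residue_ex:
  fixes x :: "'p::prime_card padic"
  assumes "padic_abs x \<le> 1"
  obtains i where "i < CARD('p)" "padic_abs (x - of_nat i) < 1"
proof -
  let ?p = "CARD('p)"
  have p: "prime ?p" by (rule prime_card)
  obtain c where c: "padic_abs (x - padic_of_seq (\<lambda>_. c)) < 1"
    using padic_rat_dense[of 1 x] by auto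
  then have c1: "rat_padic_abs ?p c \<le> 1"
    using padic_abs_add_max[of x "padic_of_seq (\<lambda>_. c) - x"] assms
    by (simp add: padic_abs_const padic_abs_minus_commute[of x])
  obtain a b where ab: "quotient_of c = (a, b)" by (cases "quotient_of c")
  have b: "b > 0" "coprime a b" and cF: "c = Rat.Fract a b"
    using ab quotient_of_denom_pos quotient_of_coprime quotient_of_div[OF ab]
    by (auto simp: Fract_of_int_quotient)
  have nd: "\<not> int ?p dvd b"
  proof
    assume d: "int ?p dvd b"
    then have na: "\<not> int ?p dvd a" using b(2) p
      by (metis coprime_common_divisor not_prime_unit prime_nat_int_transfer)
    then have "c \<noteq> 0" using ab by auto
    moreover have "rat_padic_val ?p c < 0"
      using ab na d b p by (simp add: rat_padic_val_def not_dvd_imp_multiplicity_0 prime_multiplicity_gt_zero_iff)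
    ultimately have "rat_padic_abs ?p c > 1"
      using one_less_power_int[OF padic_base_gt_1[where 'p='p]] by (simp add: rat_padic_abs_def)
    then show False using c1 by simp
  qed
  then have "coprime b (int ?p)"
    using p by (metis coprime_commute prime_imp_coprime prime_nat_int_transfer)
  then obtain u where u: "[b * u = 1] (mod int ?p)" using cong_solve_coprime_int by blast
  define i where "i = nat ((u * a) mod int ?p)"
  have ii: "int i = (u * a) mod int ?p" using prime_gt_0_nat[OF p] by (simp add: i_def)
  have ip: "i < ?p" using prime_gt_0_nat[OF p] unfolding i_def
    by (metis nat_less_iff of_nat_0_less_iff pos_mod_bound pos_mod_sign)
  have "[b * int i = b * (u * a)] (mod int ?p)" unfolding ii by (intro cong_mult) auto
  also have "b * (u * a) = (b * u) * a" by simp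
  also have "[b * u * a = 1 * a] (mod int ?p)" using u by (intro cong_mult) auto
  finally have "int ?p dvd (a - b * int i)" by (simp add: cong_iff_dvd_diff dvd_diff_commute)
  then obtain w where w: "a - b * int i = int ?p * w" by blast
  have "rat_padic_abs ?p (c - of_nat i) < 1"
  proof (cases "w = 0")
    case True
    then have "c - of_nat i = 0" using w b cF by (simp add: Fract_of_int_quotient field_simps)
    then show ?thesis by simp
  next
    case False
    have e: "c - of_nat i = Rat.Fract (int ?p * w) b"
      using b unfolding cF w[symmetric] by (simp add: Fract_of_int_quotient field_simps)
    have "rat_padic_val ?p (c - of_nat i) > 0"
      unfolding e using False b p nd
      by (subst rat_padic_val_Fract) (auto simp: not_dvd_imp_multiplicity_0 prime_multiplicity_gt_zero_iff)
    moreover have "c - of_nat i \<noteq> 0" using e False b prime_gt_0_nat[OF p] by (auto simp: Fract_of_int_quotient)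
    ultimately show ?thesis using padic_base_gt_1[where 'p='p]
      by (simp add: rat_padic_abs_def power_int_minus inverse_less_1_iff one_less_power_int)
  qed
  then have "padic_abs (padic_of_seq (\<lambda>_. c) - of_nat i :: 'p padic) < 1"
    by (simp add: padic_of_nat padic_const_diff padic_abs_const)
  then have "padic_abs (x - of_nat i) < 1"
    using padic_abs_add_max[of "x - padic_of_seq (\<lambda>_. c)" "padic_of_seq (\<lambda>_. c) - of_nat i"] c by simp
  then show ?thesis using that ip by blast
qed

section \<open>Levels, balls and spheres\<close>

lemma padic_abs_1 [simp]: "padic_abs (1 :: 'p::prime_card padic) = 1"
  using padic_abs_of_nat[of 1, where 'p='p] by simp

lemma padic_abs_0 [simp]: "padic_abs (0 :: 'p::prime_card padic) = 0"
  by simp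

lemma padic_abs_inverse: "padic_abs (inverse x) = inverse (padic_abs (x :: 'p::prime_card padic))"
proof (cases "x = 0")
  case False
  then show ?thesis using padic_abs_mult[of x "inverse x"]
    by (simp add: field_simps)
qed auto

lemma padic_abs_power: "padic_abs (x ^ n) = padic_abs (x :: 'p::prime_card padic) ^ n"
  by (induction n) (auto simp: padic_abs_mult)

lemma padic_abs_power_int: "padic_abs (x powi k) = padic_abs (x :: 'p::prime_card padic) powi k"
  by (simp add: power_int_def padic_abs_power padic_abs_inverse)

lemma padic_exists_abs:
  obtains c :: "'p::prime_card padic" where "padic_abs c = real CARD('p) powr of_int k"
proof
  have "padic_abs (of_nat CARD('p) powi (- k) :: 'p padic) = (1 / real CARD('p)) powi (- k)"
    by (simp only: padic_abs_power_int padic_abs_card)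
  also have "\<dots> = real CARD('p) powi k"
    by (simp add: power_int_minus power_int_divide_distrib)
  also have "\<dots> = real CARD('p) powr of_int k"
    using padic_base_gt_1[where 'p='p] by (simp add: powr_real_of_int')
  finally show "padic_abs (of_nat CARD('p) powi (- k) :: 'p padic) = real CARD('p) powr of_int k" .
qed

text \<open>
  For \<open>x \<noteq> 0\<close> the logarithm is an integer, and the floor only serves to change its type; in this form
  measurability of the level is inherited from the absolute value. Real powers are used for all radii, since the exponents that depend on
  \<open>\<beta>\<close>, \<open>q\<close> and \<open>\<nu>\<close> are not integers.
\<close>

definition padic_level :: "'p::prime_card padic \<Rightarrow> int" where
  "padic_level x = \<lfloor>log (real CARD('p)) (padic_abs x)\<rfloor>"

definition padic_sphere :: "int \<Rightarrow> 'p::prime_card padic set" where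
  "padic_sphere k = {x. x \<noteq> 0 \<and> padic_level x = k}"

lemma padic_level_eqI:
  "padic_abs (x :: 'p::prime_card padic) = real CARD('p) powr of_int k \<Longrightarrow> padic_level x = k"
  using padic_base_gt_1[where 'p='p] by (simp add: padic_level_def)

lemma padic_abs_eq_level:
  assumes "(x :: 'p::prime_card padic) \<noteq> 0"
  shows "padic_abs x = real CARD('p) powr of_int (padic_level x)"
proof -
  obtain k where k: "padic_abs x = real CARD('p) powi k" using padic_value_group assms by blast
  then have "padic_abs x = real CARD('p) powr of_int k"
    using padic_base_gt_1[where 'p='p] by (simp add: powr_real_of_int')
  then show ?thesis using padic_level_eqI by metis
qed

lemma padic_abs_le_iff:
  "padic_abs (x :: 'p::prime_card padic) \<le> real CARD('p) powr of_int l \<longleftrightarrow> x = 0 \<or> padic_level x \<le> l"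
proof (cases "x = 0")
  case True
  then show ?thesis using powr_gt_zero[of "real CARD('p)" "of_int l"] padic_base_gt_1[where 'p='p] by (simp add: less_imp_le)
next
  case False
  show ?thesis unfolding padic_abs_eq_level[OF False] powr_le_cancel_iff[OF padic_base_gt_1]
    using False by simp
qed

lemma padic_abs_less_iff:
  "padic_abs (x :: 'p::prime_card padic) < real CARD('p) powr of_int l \<longleftrightarrow> x = 0 \<or> padic_level x < l"
proof (cases "x = 0")
  case True
  then show ?thesis using powr_gt_zero[of "real CARD('p)" "of_int l"] padic_base_gt_1[where 'p='p] by (simp add: less_imp_le)
next
  case False
  show ?thesis unfolding padic_abs_eq_level[OF False] powr_less_cancel_iff[OF padic_base_gt_1]
    using False by simp
qed

lemma padic_ball_altdef:
  "padic_ball l a = {x. padic_abs (x - a) \<le> real CARD('p) powr of_int l}" for a :: "'p::prime_card padic"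
  using padic_base_gt_1[where 'p='p] by (simp add: padic_ball_def powr_real_of_int')

lemma mem_padic_ball_0: "x \<in> padic_ball l 0 \<longleftrightarrow> x = 0 \<or> padic_level x \<le> l"
  by (simp add: padic_ball_altdef padic_abs_le_iff)

lemma padic_abs_diff_le_iff:
  fixes a x :: "'p::prime_card padic"
  assumes "padic_abs a \<le> c"
  shows "padic_abs (x - a) \<le> c \<longleftrightarrow> padic_abs x \<le> c"
proof -
  have "padic_abs (x - a) \<le> max (padic_abs x) (padic_abs a)"
    using padic_abs_add_max[of x "- a"] by (simp only: padic_abs_minus diff_conv_add_uminus)
  moreover have "padic_abs x \<le> max (padic_abs (x - a)) (padic_abs a)"
    using padic_abs_add_max[of "x - a" a] by (simp only: diff_add_cancel)
  ultimately show ?thesis using assms by linarith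
qed

lemma padic_ball_eq_0:
  "padic_abs (a :: 'p::prime_card padic) \<le> real CARD('p) powr of_int l \<Longrightarrow> padic_ball l a = padic_ball l 0"
  by (simp add: padic_ball_altdef padic_abs_diff_le_iff)

text \<open>
  Off the origin the absolute value is locally constant: a ball that misses \<open>0\<close> lies in one sphere.
\<close>

lemma padic_ball_subset_sphere:
  assumes "\<not> padic_abs (a :: 'p::prime_card padic) \<le> real CARD('p) powr of_int l"
  shows "padic_ball l a \<subseteq> padic_sphere (padic_level a)"
proof
  fix x assume "x \<in> padic_ball l a"
  then have "padic_abs (x - a) < padic_abs a" using assms by (simp add: padic_ball_altdef)
  then have eq: "padic_abs x = padic_abs a" using padic_abs_add_eq[of "x - a" a] by simp
  have "padic_abs a > 0" using assms powr_ge_zero[of "real CARD('p)" "real_of_int l"] by linarith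
  then have "x \<noteq> 0" using eq by auto
  then show "x \<in> padic_sphere (padic_level a)" using eq by (simp add: padic_sphere_def padic_level_def)
qed

lemma padic_spheres_disjoint:
  "inj sh \<Longrightarrow> disjoint_family (\<lambda>n. padic_sphere (sh n) :: 'p::prime_card padic set)"
  by (auto simp: disjoint_family_on_def padic_sphere_def inj_def)

lemma padic_ball_eq_spheres:
  "padic_ball l (0 :: 'p::prime_card padic) = insert 0 (\<Union>n. padic_sphere (l - int n))"
proof -
  have iff: "padic_level x \<le> l \<longleftrightarrow> (\<exists>n. padic_level x = l - int n)" for x :: "'p padic"
  proof
    assume "padic_level x \<le> l"
    then have "padic_level x = l - int (nat (l - padic_level x))" by simp
    then show "\<exists>n. padic_level x = l - int n" ..
  qed auto
  show ?thesis unfolding set_eq_iff mem_padic_ball_0 iff by (auto simp only: padic_sphere_def insert_iff UN_iff mem_Collect_eq)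
qed

section \<open>Haar measure of balls and spheres, radial integrals\<close>

lemma padic_abs_measurable: "(padic_abs :: 'p::prime_card padic \<Rightarrow> real) \<in> borel_measurable borel"
proof -
  have "continuous_on UNIV (\<lambda>x::'p padic. dist x 0)" by (intro continuous_intros)
  from borel_measurable_continuous_onI[OF this] show ?thesis by (simp add: dist_padic_def)
qed

lemma padic_level_measurable:
  "(padic_level :: 'p::prime_card padic \<Rightarrow> int) \<in> borel \<rightarrow>\<^sub>M count_space UNIV"
proof -
  have "(\<lambda>x::'p padic. log (real CARD('p)) (padic_abs x)) \<in> borel_measurable borel"
    by (intro borel_measurable_log padic_abs_measurable measurable_const) auto
  from measurable_compose[OF this measurable_real_floor] show ?thesis
    by (simp add: padic_level_def[abs_def])
qed

lemma singleton_padic_borel: "{x :: 'p::prime_card padic} \<in> sets borel"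
  by (rule borel_closed[OF closed_singleton])

lemma padic_ball_borel: "padic_ball l (a :: 'p::prime_card padic) \<in> sets borel"
proof -
  have "closed {x::'p padic. dist x a \<le> real CARD('p) powr of_int l}"
    by (intro closed_Collect_le continuous_intros)
  then show ?thesis by (simp add: padic_ball_altdef dist_padic_def borel_closed)
qed

lemma padic_sphere_borel: "padic_sphere k \<in> sets (borel :: 'p::prime_card padic measure)"
proof -
  have "padic_level -` {k} \<inter> space borel - {0} \<in> sets (borel :: 'p padic measure)"
    by (intro sets.Diff measurable_sets[OF padic_level_measurable]) auto
  moreover have "padic_level -` {k} \<inter> space borel - {0} = (padic_sphere k :: 'p padic set)"
    by (auto simp: padic_sphere_def)
  ultimately show ?thesis by (simp only:)
qed

lemma padic_ball_translate: "(\<lambda>x. a + x) ` padic_ball l 0 = padic_ball l (a :: 'p::prime_card padic)"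
proof -
  have "x \<in> (\<lambda>x. a + x) ` padic_ball l 0" if "x \<in> padic_ball l a" for x
    using that by (intro image_eqI[of _ _ "x - a"]) (auto simp: padic_ball_def)
  then show ?thesis by (auto simp: padic_ball_def)
qed

text \<open>
  The value \<open>0\<close> at the origin is the one that the Cesaro average takes there, through \<open>1 / 0 = 0\<close>.
\<close>

definition padic_radial :: "(int \<Rightarrow> ennreal) \<Rightarrow> 'p::prime_card padic \<Rightarrow> ennreal" where
  "padic_radial G x = (if x = 0 then 0 else G (padic_level x))"

lemma padic_radial_measurable:
  "(padic_radial G :: 'p::prime_card padic \<Rightarrow> ennreal) \<in> borel_measurable borel"
proof -
  have "(\<lambda>x::'p padic. G (padic_level x)) \<in> borel_measurable borel"
    by (rule measurable_compose[OF padic_level_measurable]) simp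
  moreover have "{x \<in> space borel. x = (0 :: 'p padic)} \<in> sets borel"
    using singleton_padic_borel[of "0 :: 'p padic"] by simp
  ultimately have "(\<lambda>x::'p padic. if x = 0 then 0 else G (padic_level x)) \<in> borel_measurable borel"
    by (intro measurable_If measurable_const) simp_all
  then show ?thesis by (simp only: padic_radial_def[abs_def])
qed

locale padic_haar =
  fixes \<mu> :: "'p::prime_card padic measure"
  assumes haar: "normalized_haar \<mu>"
begin

lemma sets_haar: "sets \<mu> = sets borel"
  using haar by (simp add: normalized_haar_def)

lemma emeasure_ball_translate: "emeasure \<mu> (padic_ball l a) = emeasure \<mu> (padic_ball l 0)"
proof -
  have "emeasure \<mu> ((\<lambda>x. a + x) ` padic_ball l 0) = emeasure \<mu> (padic_ball l 0)"
    using haar padic_ball_borel unfolding normalized_haar_def by blast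
  then show ?thesis by (simp only: padic_ball_translate)
qed

text \<open>
  A rescaled form of the partition of the \<open>p\<close>-adic integers into residue classes. With translation
  invariance it fixes the ratio of the measures of consecutive balls, and the normalization then
  fixes the measure of every ball.
\<close>

lemma padic_ball_cosets:
  assumes c: "padic_abs (c :: 'p padic) = real CARD('p) powr of_int (l + 1)"
  shows "padic_ball (l + 1) 0 = (\<Union>i<CARD('p). padic_ball l (c * of_nat i))"
proof (intro equalityI subsetI)
  let ?P = "real CARD('p)"
  have c0: "c \<noteq> 0" using c padic_base_gt_1[where 'p='p] by auto
  fix x :: "'p padic"
  {
    assume "x \<in> padic_ball (l + 1) 0"
    then have "padic_abs x \<le> padic_abs c" by (simp add: padic_ball_altdef c)
    then have "padic_abs (x / c) \<le> 1"
      using c0 by (simp add: divide_inverse padic_abs_mult padic_abs_inverse) (simp add: field_simps order_less_le)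
    then obtain i where i: "i < CARD('p)" "padic_abs (x / c - of_nat i) < 1" by (rule padic_residue_ex)
    have "x - c * of_nat i = c * (x / c - of_nat i)" using c0 by (simp add: field_simps)
    then have "padic_abs (x - c * of_nat i) < ?P powr of_int (l + 1)"
      using i(2) padic_base_gt_1[where 'p='p] by (simp add: padic_abs_mult c)
    then have "padic_abs (x - c * of_nat i) \<le> ?P powr of_int l"
      using padic_abs_less_iff[of "x - c * of_nat i" "l + 1"] padic_abs_le_iff[of "x - c * of_nat i" l] by auto
    then show "x \<in> (\<Union>i<CARD('p). padic_ball l (c * of_nat i))" using i(1) by (auto simp: padic_ball_altdef)
  next
    assume "x \<in> (\<Union>i<CARD('p). padic_ball l (c * of_nat i))"
    then obtain i where i: "i < CARD('p)" "padic_abs (x - c * of_nat i) \<le> ?P powr of_int l"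
      by (auto simp: padic_ball_altdef)
    have "padic_abs (of_nat i :: 'p padic) \<le> 1" using padic_abs_of_nat_small[OF _ i(1)] by (cases "i = 0") auto
    then have "padic_abs (c * of_nat i) \<le> ?P powr of_int (l + 1)"
      using mult_left_mono[of "padic_abs (of_nat i :: 'p padic)" 1 "padic_abs c"] by (simp add: padic_abs_mult c)
    moreover have "?P powr of_int l \<le> ?P powr of_int (l + 1)" using padic_base_gt_1[where 'p='p] by simp
    ultimately show "x \<in> padic_ball (l + 1) 0"
      using padic_abs_add_max[of "x - c * of_nat i" "c * of_nat i"] i(2) by (simp add: padic_ball_altdef)
  }
qed

lemma padic_cosets_disjoint:
  assumes c: "padic_abs (c :: 'p padic) = real CARD('p) powr of_int (l + 1)"
  shows "disjoint_family_on (\<lambda>i. padic_ball l (c * of_nat i)) {..<CARD('p)}"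
proof -
  let ?P = "real CARD('p)"
  have *: False if ij: "i < j" "j < CARD('p)" and x: "x \<in> padic_ball l (c * of_nat i)" "x \<in> padic_ball l (c * of_nat j)"
    for i j and x :: "'p padic"
  proof -
    have "c * of_nat (j - i) = (x - c * of_nat i) - (x - c * of_nat j)"
      using ij by (simp add: of_nat_diff algebra_simps)
    then have "padic_abs (c * of_nat (j - i)) \<le> ?P powr of_int l"
      using x padic_abs_add_max[of "x - c * of_nat i" "- (x - c * of_nat j)"]
      by (simp add: padic_ball_altdef padic_abs_minus_commute[of x "c * of_nat j"])
    moreover have "padic_abs (c * of_nat (j - i)) = ?P powr of_int (l + 1)"
      using padic_abs_of_nat_small[of "j - i", where 'p='p] ij by (simp only: padic_abs_mult c)
    moreover have "?P powr of_int l < ?P powr of_int (l + 1)" using padic_base_gt_1[where 'p='p] by simp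
    ultimately show False by simp
  qed
  show ?thesis unfolding disjoint_family_on_def
    by (intro ballI impI, rule ccontr) (metis * IntE all_not_in_conv lessThan_iff linorder_neqE_nat)
qed

lemma emeasure_ball_step: "emeasure \<mu> (padic_ball (l + 1) 0) = of_nat CARD('p) * emeasure \<mu> (padic_ball l 0)"
proof -
  obtain c :: "'p padic" where c: "padic_abs c = real CARD('p) powr of_int (l + 1)" by (rule padic_exists_abs)
  have "emeasure \<mu> (padic_ball (l + 1) 0) = (\<Sum>i<CARD('p). emeasure \<mu> (padic_ball l (c * of_nat i)))"
    unfolding padic_ball_cosets[OF c]
    by (rule sum_emeasure[symmetric]) (auto simp: padic_cosets_disjoint[OF c] sets_haar padic_ball_borel)
  then show ?thesis by (simp add: emeasure_ball_translate[of l "c * _"])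
qed

lemma emeasure_ball: "emeasure \<mu> (padic_ball l a) = ennreal (real CARD('p) powr of_int l)"
proof -
  let ?P = "real CARD('p)"
  have P: "?P > 1" by (rule padic_base_gt_1)
  have "emeasure \<mu> (padic_ball l 0) = ennreal (?P powr of_int l)"
  proof (induction l rule: int_induct[of _ 0])
    case base
    have "padic_ball 0 0 = {x :: 'p padic. padic_abs x \<le> 1}" by (simp add: padic_ball_def)
    then show ?case using haar by (simp add: normalized_haar_def)
  next
    case (step1 i)
    show ?case unfolding emeasure_ball_step step1(2) using P
      by (simp add: powr_add ennreal_mult' mult.commute flip: ennreal_of_nat_eq_real_of_nat)
  next
    case (step2 i)
    have "ennreal ?P * emeasure \<mu> (padic_ball (i - 1) 0) = ennreal (?P powr of_int i)"
      using emeasure_ball_step[of "i - 1"] step2(2) by (simp add: ennreal_of_nat_eq_real_of_nat)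
    also have "\<dots> = ennreal ?P * ennreal (?P powr of_int (i - 1))"
      using P by (simp add: powr_diff flip: ennreal_mult')
    finally show ?case using P by (simp add: ennreal_mult_cancel_left)
  qed
  then show ?thesis by (simp add: emeasure_ball_translate[of l a])
qed

lemma measure_ball: "measure \<mu> (padic_ball l a) = real CARD('p) powr of_int l"
  by (simp add: measure_def emeasure_ball)

lemma emeasure_sphere:
  "emeasure \<mu> (padic_sphere k) = ennreal ((1 - 1 / real CARD('p)) * real CARD('p) powr of_int k)"
proof -
  let ?P = "real CARD('p)"
  have P: "?P > 1" by (rule padic_base_gt_1)
  have "padic_sphere k = padic_ball k 0 - padic_ball (k - 1) (0 :: 'p padic)"
    by (auto simp: mem_padic_ball_0 padic_sphere_def)
  moreover have "emeasure \<mu> (padic_ball k 0 - padic_ball (k - 1) 0)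
      = emeasure \<mu> (padic_ball k 0) - emeasure \<mu> (padic_ball (k - 1) 0)"
    by (rule emeasure_Diff) (auto simp: sets_haar padic_ball_borel emeasure_ball mem_padic_ball_0)
  moreover have "?P powr of_int k - ?P powr of_int (k - 1) = (1 - 1 / ?P) * ?P powr of_int k"
    using P by (simp add: powr_diff field_simps)
  ultimately show ?thesis using ennreal_minus[of "?P powr of_int (k - 1)" "?P powr of_int k"]
    by (simp only: emeasure_ball powr_ge_zero simp_thms)
qed

lemma AE_haar_nonzero: "AE x in \<mu>. x \<noteq> 0"
proof -
  let ?P = "real CARD('p)"
  have P: "?P > 1" by (rule padic_base_gt_1)
  have "emeasure \<mu> {0} \<le> ennreal ((1 / ?P) ^ n)" for n
  proof -
    have "emeasure \<mu> {0} \<le> emeasure \<mu> (padic_ball (- int n) 0)"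
      by (rule emeasure_mono) (auto simp: mem_padic_ball_0 sets_haar padic_ball_borel)
    also have "\<dots> = ennreal ((1 / ?P) ^ n)"
      using P by (simp add: emeasure_ball powr_minus powr_realpow power_divide field_simps)
    finally show ?thesis .
  qed
  moreover have "(\<lambda>n. ennreal ((1 / ?P) ^ n)) \<longlonglongrightarrow> ennreal 0"
    using P by (intro tendsto_ennrealI LIMSEQ_realpow_zero) auto
  ultimately have "emeasure \<mu> {0} \<le> 0" by (intro LIMSEQ_le_const) auto
  then have "{0} \<in> null_sets \<mu>" by (auto simp: sets_haar singleton_padic_borel)
  then show ?thesis by (rule AE_I') auto
qed

lemma borel_measurable_haar_restrict:
  fixes u :: "'p padic \<Rightarrow> ennreal"
  assumes "u \<in> borel_measurable borel" "A \<in> sets borel"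
  shows "(\<lambda>x. u x * indicator A x) \<in> borel_measurable \<mu>"
  unfolding measurable_cong_sets[OF sets_haar refl]
  using assms by (intro borel_measurable_times_ennreal borel_measurable_indicator)

lemma nn_integral_spheres:
  assumes meas: "u \<in> borel_measurable borel" and inj: "inj sh"
  shows "(\<integral>\<^sup>+t\<in>(\<Union>n. padic_sphere (sh n)). u t \<partial>\<mu>) = (\<Sum>n. \<integral>\<^sup>+t\<in>padic_sphere (sh n). u t \<partial>\<mu>)"
proof -
  have "(\<integral>\<^sup>+t\<in>(\<Union>n. padic_sphere (sh n)). u t \<partial>\<mu>)
      = (\<integral>\<^sup>+t. (\<Sum>n. u t * indicator (padic_sphere (sh n)) t) \<partial>\<mu>)"
    by (intro nn_integral_cong) (simp add: suminf_indicator[OF padic_spheres_disjoint[OF inj]])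
  also have "\<dots> = (\<Sum>n. \<integral>\<^sup>+t\<in>padic_sphere (sh n). u t \<partial>\<mu>)"
    by (intro nn_integral_suminf borel_measurable_haar_restrict meas padic_sphere_borel)
  finally show ?thesis .
qed

lemma nn_integral_ball_spheres:
  assumes meas: "u \<in> borel_measurable borel"
  shows "(\<integral>\<^sup>+t\<in>padic_ball l 0. u t \<partial>\<mu>) = (\<Sum>n. \<integral>\<^sup>+t\<in>padic_sphere (l - int n). u t \<partial>\<mu>)"
proof -
  have "(\<integral>\<^sup>+t\<in>padic_ball l 0. u t \<partial>\<mu>) = (\<integral>\<^sup>+t\<in>(\<Union>n. padic_sphere (l - int n)). u t \<partial>\<mu>)"
    using AE_haar_nonzero
    by (intro nn_integral_cong_AE) (auto elim!: eventually_mono simp: padic_ball_eq_spheres indicator_def)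
  then show ?thesis by (simp add: nn_integral_spheres[OF meas] inj_def)
qed

lemma nn_integral_radial_subset_sphere:
  assumes "A \<subseteq> padic_sphere k" "A \<in> sets borel"
  shows "(\<integral>\<^sup>+x\<in>A. padic_radial G x \<partial>\<mu>) = G k * emeasure \<mu> A"
proof -
  have "(\<integral>\<^sup>+x\<in>A. padic_radial G x \<partial>\<mu>) = (\<integral>\<^sup>+x. G k * indicator A x \<partial>\<mu>)"
    using assms(1) by (intro nn_integral_cong) (auto simp: indicator_def padic_radial_def padic_sphere_def)
  also have "\<dots> = G k * emeasure \<mu> A"
    using assms(2) by (intro nn_integral_cmult_indicator) (simp add: sets_haar)
  finally show ?thesis .
qed

lemma nn_integral_radial_ball_0:
  "(\<integral>\<^sup>+x\<in>padic_ball l 0. padic_radial G x \<partial>\<mu>) = (\<Sum>n. G (l - int n) * emeasure \<mu> (padic_sphere (l - int n)))"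
  by (simp add: nn_integral_ball_spheres[OF padic_radial_measurable] padic_radial_measurable
      nn_integral_radial_subset_sphere[OF subset_refl padic_sphere_borel])

lemma emeasure_sphere_shift:
  "emeasure \<mu> (padic_sphere k) = ennreal (real CARD('p) powr - of_int s) * emeasure \<mu> (padic_sphere (k + s))"
  using padic_base_gt_1[where 'p='p]
  by (simp add: emeasure_sphere powr_add powr_minus field_simps flip: ennreal_mult')

text \<open>
  The change of variables \<open>x \<mapsto> c * x\<close> for radial functions. A ball is either centred at \<open>0\<close>, hence
  up to a null set a union of spheres, or it lies inside a single sphere. In both cases the claim
  reduces to the way in which the measures of spheres and of balls depend on the radius.
\<close>

lemma nn_integral_radial_shift:
  fixes a c :: "'p padic"
  assumes c: "padic_abs c = real CARD('p) powr of_int s"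
  shows "(\<integral>\<^sup>+x\<in>padic_ball l a. padic_radial (\<lambda>k. G (k + s)) x \<partial>\<mu>)
    = ennreal (real CARD('p) powr - of_int s) * (\<integral>\<^sup>+x\<in>padic_ball (l + s) (c * a). padic_radial G x \<partial>\<mu>)"
proof -
  let ?P = "real CARD('p)"
  have P: "?P > 1" by (rule padic_base_gt_1)
  have iff: "padic_abs (c * a) \<le> ?P powr of_int (l + s) \<longleftrightarrow> padic_abs a \<le> ?P powr of_int l"
    using P by (simp add: padic_abs_mult c powr_add mult.commute)
  show ?thesis
  proof (cases "padic_abs a \<le> ?P powr of_int l")
    case True
    have "G (l - int n + s) * emeasure \<mu> (padic_sphere (l - int n)) = ennreal (?P powr - of_int s) *
        (G (l + s - int n) * emeasure \<mu> (padic_sphere (l + s - int n)))" for n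
      by (subst emeasure_sphere_shift[of _ s]) (simp add: algebra_simps)
    then show ?thesis
      unfolding padic_ball_eq_0[OF True] padic_ball_eq_0[OF iff[THEN iffD2, OF True]] nn_integral_radial_ball_0
      by simp
  next
    case False
    have a0: "a \<noteq> 0" using False by auto
    have "padic_abs (c * a) = ?P powr of_int (padic_level a + s)"
      using a0 P by (simp add: padic_abs_mult c padic_abs_eq_level[OF a0] powr_add)
    then have lv: "padic_level (c * a) = padic_level a + s" by (rule padic_level_eqI)
    have "ennreal (?P powr of_int l) = ennreal (?P powr - of_int s) * ennreal (?P powr of_int (l + s))"
      using P by (simp add: powr_add powr_minus field_simps flip: ennreal_mult')
    moreover have far: "\<not> padic_abs (c * a) \<le> ?P powr of_int (l + s)" using False iff by simp
    ultimately show ?thesis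
      unfolding nn_integral_radial_subset_sphere[OF padic_ball_subset_sphere[OF False] padic_ball_borel]
        nn_integral_radial_subset_sphere[OF padic_ball_subset_sphere[OF far] padic_ball_borel] lv emeasure_ball
      by (simp add: mult_ac)
  qed
qed

end

section \<open>Powers in the extended half-line and Jensen's inequality\<close>

lemma ennreal_powr_ennreal: "x \<ge> 0 \<Longrightarrow> ennreal_powr (ennreal x) r = ennreal (x powr r)"
  by (simp add: ennreal_powr_def)

lemma ennreal_powr_mono:
  assumes "x \<le> y" "r > 0"
  shows "ennreal_powr x r \<le> ennreal_powr y r"
proof (cases "y = \<infinity>")
  case False
  then have "x \<noteq> \<infinity>" using assms(1) by (auto simp: top_unique)
  then show ?thesis using False assms
    by (auto simp: ennreal_powr_def intro!: ennreal_leI powr_mono2 enn2real_mono simp: less_top)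
qed (simp add: ennreal_powr_def)

lemma ennreal_powr_0 [simp]: "ennreal_powr 0 r = 0"
  by (simp add: ennreal_powr_def)

lemma ennreal_powr_inverse:
  assumes "r > 0"
  shows "ennreal_powr (ennreal_powr x r) (1 / r) = x" "ennreal_powr (ennreal_powr x (1 / r)) r = x"
  using assms by (cases x; simp add: ennreal_powr_def powr_powr)+

lemma ennreal_powr_le_iff:
  assumes "r > 0"
  shows "ennreal_powr x (1 / r) \<le> y \<longleftrightarrow> x \<le> ennreal_powr y r"
  using ennreal_powr_mono[of "ennreal_powr x (1 / r)" y r] ennreal_powr_mono[of x "ennreal_powr y r" "1 / r"]
    ennreal_powr_inverse[OF assms] assms by auto

lemma ennreal_powr_cmult:
  assumes "r > 0" "a \<ge> 0"
  shows "ennreal_powr (ennreal a * x) r = ennreal (a powr r) * ennreal_powr x r"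
proof (cases "x = \<infinity>")
  case True
  then show ?thesis using assms by (cases "a = 0") (auto simp: ennreal_powr_def ennreal_mult_top)
next
  case False
  then obtain b where b: "x = ennreal b" "b \<ge> 0" by (cases x) auto
  then show ?thesis using assms
    by (simp add: ennreal_powr_ennreal powr_mult flip: ennreal_mult)
qed

text \<open>
  Jensen's inequality for \<open>x\<^sup>r\<close> with weights of arbitrary total mass. The convexity of the power
  function is used on the open half-line, hence the passage to the indices \<open>J\<close> with \<open>g i > 0\<close>.
\<close>

lemma powr_sum_le:
  fixes u g :: "'a \<Rightarrow> real"
  assumes "finite I" "r \<ge> 1" and u: "\<And>i. i \<in> I \<Longrightarrow> u i > 0" and g: "\<And>i. i \<in> I \<Longrightarrow> g i \<ge> 0"
  shows "(\<Sum>i\<in>I. u i * g i) powr r \<le> (\<Sum>i\<in>I. u i) powr (r - 1) * (\<Sum>i\<in>I. u i * g i powr r)"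
proof -
  define J where "J = {i \<in> I. g i > 0}"
  have J: "finite J" "J \<subseteq> I" using assms(1) by (auto simp: J_def)
  have sJ: "(\<Sum>i\<in>I. u i * g i) = (\<Sum>i\<in>J. u i * g i)" "(\<Sum>i\<in>I. u i * g i powr r) = (\<Sum>i\<in>J. u i * g i powr r)"
    using assms(1) g by (auto intro!: sum.mono_neutral_right simp: J_def order_less_le)
  show ?thesis
  proof (cases "J = {}")
    case True
    then show ?thesis by (simp add: sJ)
  next
    case False
    define T where "T = (\<Sum>i\<in>J. u i)"
    have T: "T > 0" unfolding T_def using J u False by (intro sum_pos) auto
    have "(\<Sum>i\<in>J. u i / T) = 1" using T by (simp add: T_def flip: sum_divide_distrib)
    then have "(\<Sum>i\<in>J. (u i / T) *\<^sub>R g i) powr r \<le> (\<Sum>i\<in>J. (u i / T) * g i powr r)"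
      using J u T by (intro convex_on_sum[OF J(1) False powr_convex[OF assms(2)]]) (auto simp: J_def less_imp_le)
    then have "((\<Sum>i\<in>J. u i * g i) / T) powr r \<le> (\<Sum>i\<in>J. u i * g i powr r) / T"
      by (simp add: sum_divide_distrib)
    moreover have "(\<Sum>i\<in>J. u i * g i) \<ge> 0" using J u g by (intro sum_nonneg mult_nonneg_nonneg) (auto intro: less_imp_le)
    ultimately have "(\<Sum>i\<in>J. u i * g i) powr r \<le> T powr r * ((\<Sum>i\<in>J. u i * g i powr r) / T)"
      using T by (simp add: powr_divide pos_divide_le_eq mult.commute)
    also have "\<dots> = T powr (r - 1) * (\<Sum>i\<in>J. u i * g i powr r)"
      using T by (simp add: powr_diff)
    also have "\<dots> \<le> (\<Sum>i\<in>I. u i) powr (r - 1) * (\<Sum>i\<in>J. u i * g i powr r)"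
    proof (intro mult_right_mono powr_mono2)
      show "T \<le> (\<Sum>i\<in>I. u i)" unfolding T_def using J assms(1) u by (intro sum_mono2) (auto intro: less_imp_le)
      show "0 \<le> (\<Sum>i\<in>J. u i * g i powr r)" using J u by (intro sum_nonneg mult_nonneg_nonneg) (auto intro: less_imp_le)
    qed (use T assms in auto)
    finally show ?thesis by (simp add: sJ)
  qed
qed

text \<open>
  The finite sums satisfy the estimate by the previous lemma. Taking \<open>r\<close>-th roots turns it into a
  uniform bound for the partial sums, which passes to the series.
\<close>

lemma ennreal_powr_suminf_le:
  fixes G :: "nat \<Rightarrow> ennreal"
  assumes u: "\<And>n. u n > 0" "summable u" and r: "r \<ge> 1"
  shows "ennreal_powr (\<Sum>n. ennreal (u n) * G n) r
    \<le> ennreal (suminf u powr (r - 1)) * (\<Sum>n. ennreal (u n) * ennreal_powr (G n) r)"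
    (is "_ \<le> ?R")
proof -
  have S: "suminf u > 0" using u by (simp add: suminf_pos)
  have *: "ennreal_powr (\<Sum>n<N. ennreal (u n) * G n) r \<le> ?R" for N
  proof (cases "\<exists>n<N. G n = \<infinity>")
    case True
    \<comment> \<open>The weights are positive, so one infinite term makes the right-hand side infinite.\<close>
    then obtain n where n: "G n = \<infinity>" by auto
    have "ennreal (u n) * ennreal_powr (G n) r \<le> (\<Sum>n. ennreal (u n) * ennreal_powr (G n) r)"
      using sum_le_suminf[of "\<lambda>n. ennreal (u n) * ennreal_powr (G n) r" "{n}"] by (simp add: summableI)
    moreover have "ennreal (u n) * ennreal_powr (G n) r = \<infinity>"
      using n u(1)[of n] by (simp add: ennreal_powr_def ennreal_mult_top)
    ultimately have "(\<Sum>n. ennreal (u n) * ennreal_powr (G n) r) = \<infinity>" by (simp add: top_unique)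
    then have "?R = \<infinity>" using S by (simp add: ennreal_mult_top)
    then show ?thesis by simp
  next
    case False
    define g where "g n = enn2real (G n)" for n
    have G: "G n = ennreal (g n)" if "n < N" for n using False that by (auto simp: g_def less_top)
    have g0: "g n \<ge> 0" for n by (simp add: g_def)
    have "(\<Sum>n<N. ennreal (u n) * G n) = (\<Sum>n<N. ennreal (u n * g n))"
      using u(1) g0 G by (intro sum.cong) (auto simp: ennreal_mult less_imp_le)
    also have "\<dots> = ennreal (\<Sum>n<N. u n * g n)"
      using u(1) g0 by (intro sum_ennreal) (simp add: less_imp_le)
    finally have sum_eq: "(\<Sum>n<N. ennreal (u n) * G n) = ennreal (\<Sum>n<N. u n * g n)" .
    have "(\<Sum>n<N. ennreal (u n) * ennreal_powr (G n) r) = (\<Sum>n<N. ennreal (u n * g n powr r))"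
      using u(1) g0 G by (intro sum.cong) (auto simp: ennreal_mult ennreal_powr_ennreal less_imp_le)
    also have "\<dots> = ennreal (\<Sum>n<N. u n * g n powr r)"
      using u(1) by (intro sum_ennreal) (simp add: less_imp_le)
    finally have sum_eq': "(\<Sum>n<N. ennreal (u n) * ennreal_powr (G n) r) = ennreal (\<Sum>n<N. u n * g n powr r)" .
    have nn: "(\<Sum>n<N. u n * g n) \<ge> 0" "(\<Sum>n<N. u n * g n powr r) \<ge> 0"
      using u(1) g0 by (auto intro!: sum_nonneg simp: less_imp_le)
    have "ennreal_powr (\<Sum>n<N. ennreal (u n) * G n) r = ennreal ((\<Sum>n<N. u n * g n) powr r)"
      unfolding sum_eq using nn by (intro ennreal_powr_ennreal)
    also have "\<dots> \<le> ennreal ((\<Sum>n<N. u n) powr (r - 1) * (\<Sum>n<N. u n * g n powr r))"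
      using u(1) g0 r by (intro ennreal_leI powr_sum_le) auto
    also have "\<dots> \<le> ennreal (suminf u powr (r - 1) * (\<Sum>n<N. u n * g n powr r))"
      using u r by (intro ennreal_leI mult_right_mono powr_mono2 sum_le_suminf sum_nonneg)
        (auto simp: less_imp_le)
    also have "\<dots> = ennreal (suminf u powr (r - 1)) * (\<Sum>n<N. ennreal (u n) * ennreal_powr (G n) r)"
      unfolding sum_eq' using nn by (intro ennreal_mult) auto
    also have "\<dots> \<le> ?R"
      by (intro mult_left_mono sum_le_suminf) (auto simp: summableI)
    finally show ?thesis .
  qed
  have "(\<Sum>n. ennreal (u n) * G n) \<le> ennreal_powr ?R (1 / r)"
  proof (rule suminf_le_const[OF summableI])
    fix N
    have "ennreal_powr (ennreal_powr (\<Sum>n<N. ennreal (u n) * G n) r) (1 / r) \<le> ennreal_powr ?R (1 / r)"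
      using r by (intro ennreal_powr_mono *) auto
    then show "(\<Sum>n<N. ennreal (u n) * G n) \<le> ennreal_powr ?R (1 / r)"
      using r by (simp add: ennreal_powr_inverse)
  qed
  then have "ennreal_powr (\<Sum>n. ennreal (u n) * G n) r \<le> ennreal_powr (ennreal_powr ?R (1 / r)) r"
    using r by (intro ennreal_powr_mono) auto
  then show ?thesis using r by (simp add: ennreal_powr_inverse)
qed

lemma ennreal_suminf_swap:
  fixes f :: "nat \<Rightarrow> nat \<Rightarrow> ennreal"
  shows "(\<Sum>i. \<Sum>n. f i n) = (\<Sum>n. \<Sum>i. f i n)"
proof -
  have "(\<Sum>i. \<Sum>n. f i n) = (\<integral>\<^sup>+i. (\<Sum>n. f i n) \<partial>count_space UNIV)"
    by (simp add: nn_integral_count_space_nat)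
  also have "\<dots> = (\<Sum>n. \<integral>\<^sup>+i. f i n \<partial>count_space UNIV)"
    by (rule nn_integral_suminf) simp
  finally show ?thesis by (simp add: nn_integral_count_space_nat)
qed

lemma padic_radial_powr: "ennreal_powr (padic_radial G x) r = padic_radial (\<lambda>k. ennreal_powr (G k) r) x"
  by (simp add: padic_radial_def)

section \<open>The Cesaro-Morrey norm through radial functions\<close>

text \<open>
  The value of the Cesaro average of \<open>f\<close> on the sphere \<open>\<bar>x\<bar> = p\<^sup>k\<close>.
\<close>

definition cesaro_level ::
  "'p::prime_card padic measure \<Rightarrow> real \<Rightarrow> ('p padic \<Rightarrow> complex) \<Rightarrow> int \<Rightarrow> ennreal" where
  "cesaro_level \<mu> \<beta> f k = ennreal (real CARD('p) powr ((\<beta> - 1) * of_int k)) *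
     (\<integral>\<^sup>+t\<in>padic_ball k 0. ennreal (cmod (f t)) \<partial>\<mu>)"

context padic_haar
begin

text \<open>
  The assertion that the Morrey norm of the radial function \<open>G\<close> is at most \<open>X\<close>, with the
  \<open>r\<close>-th root and the negative power of the measure of the ball cleared. In this form it
  can be summed and integrated.
\<close>

definition morrey_bound :: "real \<Rightarrow> real \<Rightarrow> (int \<Rightarrow> ennreal) \<Rightarrow> ennreal \<Rightarrow> bool" where
  "morrey_bound r q G X \<longleftrightarrow> (\<forall>a l.
     (\<integral>\<^sup>+x\<in>padic_ball l a. padic_radial (\<lambda>k. ennreal_powr (G k) r) x \<partial>\<mu>)
       \<le> ennreal_powr X r * ennreal (real CARD('p) powr (of_int l * (1 - r / q))))"

lemma cesaro_level_radial:
  fixes x :: "'p padic"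
  shows "ennreal (1 / padic_abs x powr (1 - \<beta>)) *
     (\<integral>\<^sup>+ t \<in> {t. padic_abs t \<le> padic_abs x}. ennreal (cmod (f t)) \<partial>\<mu>)
   = padic_radial (cesaro_level \<mu> \<beta> f) x"
proof (cases "x = 0")
  case False
  have ball: "{t :: 'p padic. padic_abs t \<le> padic_abs x} = padic_ball (padic_level x) 0"
    unfolding padic_ball_altdef padic_abs_eq_level[OF False] by simp
  have "1 / padic_abs x powr (1 - \<beta>) = real CARD('p) powr ((\<beta> - 1) * of_int (padic_level x))"
    unfolding padic_abs_eq_level[OF False] powr_powr inverse_eq_divide[symmetric] powr_minus[symmetric]
    by (simp add: algebra_simps)
  then show ?thesis using False by (simp add: padic_radial_def cesaro_level_def ball)
qed (simp add: padic_radial_def)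

lemma cesaro_morrey_norm_le_iff:
  assumes r: "r > 0" and q: "q > 0"
  shows "cesaro_morrey_norm \<mu> \<beta> r q f \<le> X \<longleftrightarrow> morrey_bound r q (cesaro_level \<mu> \<beta> f) X"
proof -
  let ?P = "real CARD('p)"
  have P: "?P > 1" by (rule padic_base_gt_1)
  have *: "ennreal ((?P powr of_int l) powr (1 / q - 1 / r)) * ennreal_powr I (1 / r) \<le> X
      \<longleftrightarrow> I \<le> ennreal_powr X r * ennreal (?P powr (of_int l * (1 - r / q)))" for I l
  proof -
    define w where "w = ?P powr (of_int l * (1 / q - 1 / r))"
    have w: "w > 0" using P by (simp add: w_def)
    have "- (of_int l * (1 / q - 1 / r)) * r = of_int l * (- (1 / q - 1 / r) * r)"
      by (simp only: mult_minus_left mult_minus_right mult.assoc)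
    also have "- (1 / q - 1 / r) * r = 1 - r / q" using r by (simp add: left_diff_distrib)
    finally have wr: "(1 / w) powr r = ?P powr (of_int l * (1 - r / q))"
      unfolding w_def inverse_eq_divide[symmetric] powr_minus[symmetric] powr_powr by simp
    have "ennreal w * ennreal_powr I (1 / r) \<le> X \<longleftrightarrow> ennreal_powr I (1 / r) \<le> ennreal (1 / w) * X"
    proof
      assume "ennreal w * ennreal_powr I (1 / r) \<le> X"
      then have "ennreal (1 / w) * (ennreal w * ennreal_powr I (1 / r)) \<le> ennreal (1 / w) * X"
        by (rule mult_left_mono) simp
      then show "ennreal_powr I (1 / r) \<le> ennreal (1 / w) * X"
        using w by (simp add: mult.assoc[symmetric] flip: ennreal_mult)
    next
      assume "ennreal_powr I (1 / r) \<le> ennreal (1 / w) * X"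
      then have "ennreal w * ennreal_powr I (1 / r) \<le> ennreal w * (ennreal (1 / w) * X)"
        by (rule mult_left_mono) simp
      then show "ennreal w * ennreal_powr I (1 / r) \<le> X"
        using w by (simp add: mult.assoc[symmetric] flip: ennreal_mult)
    qed
    also have "\<dots> \<longleftrightarrow> I \<le> ennreal_powr (ennreal (1 / w) * X) r"
      by (rule ennreal_powr_le_iff[OF r])
    also have "ennreal_powr (ennreal (1 / w) * X) r = ennreal_powr X r * ennreal (?P powr (of_int l * (1 - r / q)))"
      using w r by (subst ennreal_powr_cmult) (simp_all only: wr mult.commute zero_le_divide_1_iff less_imp_le)
    finally show ?thesis by (simp add: w_def powr_powr)
  qed
  show ?thesis
    unfolding cesaro_morrey_norm_def cesaro_level_radial measure_ball morrey_bound_def padic_radial_powr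
    by (auto simp: SUP_le_iff *)
qed

text \<open>
  A radial function is constant on a sphere, which has positive measure; an infinite value would
  make the integral over the surrounding ball infinite.
\<close>

lemma morrey_bound_finite:
  assumes "morrey_bound r q G X" "X < \<infinity>" "r > 0"
  shows "G k < \<infinity>"
proof -
  let ?P = "real CARD('p)"
  have P: "?P > 1" by (rule padic_base_gt_1)
  have "ennreal_powr (G k) r * emeasure \<mu> (padic_sphere k)
      = (\<integral>\<^sup>+x\<in>padic_sphere k. padic_radial (\<lambda>k. ennreal_powr (G k) r) x \<partial>\<mu>)"
    by (rule nn_integral_radial_subset_sphere[OF subset_refl padic_sphere_borel, symmetric])
  also have "\<dots> \<le> (\<integral>\<^sup>+x\<in>padic_ball k 0. padic_radial (\<lambda>k. ennreal_powr (G k) r) x \<partial>\<mu>)"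
    by (intro nn_integral_mono mult_left_mono) (auto simp: indicator_def mem_padic_ball_0 padic_sphere_def)
  also have "\<dots> \<le> ennreal_powr X r * ennreal (?P powr (of_int k * (1 - r / q)))"
    using assms(1) by (auto simp: morrey_bound_def)
  also have "\<dots> < \<infinity>" using assms(2) by (simp add: ennreal_powr_def ennreal_mult_less_top)
  finally have *: "ennreal_powr (G k) r * emeasure \<mu> (padic_sphere k) < \<infinity>" .
  have "(1 - 1 / ?P) * ?P powr of_int k > 0" using P by simp
  then have "emeasure \<mu> (padic_sphere k) \<noteq> 0"
    unfolding emeasure_sphere ennreal_eq_0_iff by linarith
  then have "ennreal_powr (G k) r \<noteq> \<infinity>" using * by (auto simp: ennreal_top_mult)
  then show ?thesis by (cases "G k = \<infinity>") (auto simp: ennreal_powr_def less_top)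
qed

lemma morrey_bound_mono:
  assumes "morrey_bound r q H X" "r > 0" "\<And>k. G k \<le> H k"
  shows "morrey_bound r q G X"
  unfolding morrey_bound_def
proof (intro allI)
  fix a :: "'p padic" and l
  have "(\<integral>\<^sup>+x\<in>padic_ball l a. padic_radial (\<lambda>k. ennreal_powr (G k) r) x \<partial>\<mu>)
      \<le> (\<integral>\<^sup>+x\<in>padic_ball l a. padic_radial (\<lambda>k. ennreal_powr (H k) r) x \<partial>\<mu>)"
    using assms(2,3)
    by (intro nn_integral_mono mult_right_mono) (auto simp: padic_radial_def intro!: ennreal_powr_mono)
  also have "\<dots> \<le> ennreal_powr X r * ennreal (real CARD('p) powr (of_int l * (1 - r / q)))"
    using assms(1) unfolding morrey_bound_def by blast
  finally show "(\<integral>\<^sup>+x\<in>padic_ball l a. padic_radial (\<lambda>k. ennreal_powr (G k) r) x \<partial>\<mu>)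
      \<le> ennreal_powr X r * ennreal (real CARD('p) powr (of_int l * (1 - r / q)))" .
qed

text \<open>
  Shifting the level by \<open>sh n\<close> is a dilation, which multiplies the Morrey norm by \<open>p\<close> to the power
  \<open>- sh n / q\<close>. So the rescaled shifts \<open>p^(sh n / q) * G (k + sh n)\<close> all satisfy the same bound as
  \<open>G\<close>. Jensen's inequality with the weights \<open>u n = c n * p^(- sh n / q)\<close> transfers this bound
  to the series; it takes the place of Minkowski's inequality in \<open>L\<^sup>r\<close>.
\<close>

lemma morrey_bound_shift_sum:
  assumes r: "r \<ge> 1" and q: "q > 0"
    and G: "morrey_bound r q G X"
    and c: "\<And>n. c n > 0" and sm: "summable (\<lambda>n. c n * real CARD('p) powr (- of_int (sh n) / q))"
    and H: "\<And>k. H k \<le> (\<Sum>n. ennreal (c n) * G (k + sh n))"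
  shows "morrey_bound r q H (ennreal (\<Sum>n. c n * real CARD('p) powr (- of_int (sh n) / q)) * X)"
  unfolding morrey_bound_def
proof (intro allI)
  fix a :: "'p padic" and l :: int
  let ?P = "real CARD('p)"
  have P: "?P > 1" by (rule padic_base_gt_1)
  define u where "u n = c n * ?P powr (- of_int (sh n) / q)" for n
  define S where "S = suminf u"
  have u: "u n > 0" for n using c P by (simp add: u_def)
  have su: "summable u" using sm unfolding u_def .
  have S: "S > 0" unfolding S_def using su u by (simp add: suminf_pos)
  have cu: "ennreal (c n) * g = ennreal (u n) * (ennreal (?P powr (of_int (sh n) / q)) * g)" for n g
  proof -
    have "c n = u n * ?P powr (of_int (sh n) / q)" using P by (simp add: u_def powr_minus)
    then have "ennreal (c n) = ennreal (u n) * ennreal (?P powr (of_int (sh n) / q))"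
      using u by (simp add: less_imp_le ennreal_mult)
    then show ?thesis by (simp add: mult.assoc)
  qed
  let ?w = "\<lambda>n. ennreal (?P powr (of_int (sh n) * r / q))"
  let ?g = "\<lambda>n. padic_radial (\<lambda>k. ennreal_powr (G (k + sh n)) r) :: 'p padic \<Rightarrow> ennreal"
  have Hr: "ennreal_powr (H k) r
      \<le> ennreal (S powr (r - 1)) * (\<Sum>n. ennreal (u n) * (?w n * ennreal_powr (G (k + sh n)) r))" for k
  proof -
    have "H k \<le> (\<Sum>n. ennreal (u n) * (ennreal (?P powr (of_int (sh n) / q)) * G (k + sh n)))"
      using H[of k] unfolding cu .
    then have "ennreal_powr (H k) r \<le> ennreal_powr (\<Sum>n. ennreal (u n) * (ennreal (?P powr (of_int (sh n) / q)) * G (k + sh n))) r"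
      using r by (intro ennreal_powr_mono) auto
    also have "\<dots> \<le> ennreal (S powr (r - 1)) *
        (\<Sum>n. ennreal (u n) * ennreal_powr (ennreal (?P powr (of_int (sh n) / q)) * G (k + sh n)) r)"
      unfolding S_def by (rule ennreal_powr_suminf_le[OF u su r])
    finally show ?thesis using r by (simp add: ennreal_powr_cmult powr_powr)
  qed
  have int: "(\<integral>\<^sup>+x\<in>padic_ball l a. ?g n x \<partial>\<mu>)
      \<le> ennreal (?P powr - of_int (sh n)) * (ennreal_powr X r * ennreal (?P powr (of_int (l + sh n) * (1 - r / q))))" for n
  proof -
    obtain d :: "'p padic" where d: "padic_abs d = ?P powr of_int (sh n)" by (rule padic_exists_abs)
    show ?thesis
      unfolding nn_integral_radial_shift[OF d, of "\<lambda>k. ennreal_powr (G k) r"]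
      using G[unfolded morrey_bound_def, rule_format, where a = "d * a" and l = "l + sh n"]
      by (rule mult_left_mono) simp
  qed
  have "(\<integral>\<^sup>+x\<in>padic_ball l a. padic_radial (\<lambda>k. ennreal_powr (H k) r) x \<partial>\<mu>)
      \<le> (\<integral>\<^sup>+x. ennreal (S powr (r - 1)) * (\<Sum>n. ennreal (u n) * ?w n * (?g n x * indicator (padic_ball l a) x)) \<partial>\<mu>)"
    using Hr by (intro nn_integral_mono) (auto simp: padic_radial_def indicator_def mult.assoc)
  also have "\<dots> = ennreal (S powr (r - 1)) * (\<Sum>n. ennreal (u n) * ?w n * (\<integral>\<^sup>+x\<in>padic_ball l a. ?g n x \<partial>\<mu>))"
  proof -
    have m: "(\<lambda>x. ?g n x * indicator (padic_ball l a) x) \<in> borel_measurable \<mu>" for n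
      by (intro borel_measurable_haar_restrict padic_radial_measurable padic_ball_borel)
    have m2: "(\<lambda>x. ennreal (u n) * ?w n * (?g n x * indicator (padic_ball l a) x)) \<in> borel_measurable \<mu>" for n
      by (intro borel_measurable_times_ennreal m measurable_const) auto
    show ?thesis
      by (simp add: nn_integral_cmult borel_measurable_suminf_order m m2 nn_integral_suminf)
  qed
  also have "\<dots> \<le> ennreal (S powr (r - 1)) * (\<Sum>n. ennreal (u n) * (ennreal_powr X r * ennreal (?P powr (of_int l * (1 - r / q)))))"
  proof (intro mult_left_mono suminf_le summableI)
    fix n
    have e: "?P powr (of_int (sh n) * r / q) * (?P powr - of_int (sh n) * ?P powr (of_int (l + sh n) * (1 - r / q)))
        = ?P powr (of_int l * (1 - r / q))"
      using q by (simp add: field_simps flip: powr_add)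
    have "ennreal (u n) * ?w n * (\<integral>\<^sup>+x\<in>padic_ball l a. ?g n x \<partial>\<mu>) \<le> ennreal (u n) * ?w n *
        (ennreal (?P powr - of_int (sh n)) * (ennreal_powr X r * ennreal (?P powr (of_int (l + sh n) * (1 - r / q)))))"
      by (intro mult_left_mono int) auto
    also have "\<dots> = ennreal (u n) * (ennreal_powr X r * (?w n *
        (ennreal (?P powr - of_int (sh n)) * ennreal (?P powr (of_int (l + sh n) * (1 - r / q))))))"
      by (simp only: mult_ac)
    also have "?w n * (ennreal (?P powr - of_int (sh n)) * ennreal (?P powr (of_int (l + sh n) * (1 - r / q))))
        = ennreal (?P powr (of_int l * (1 - r / q)))"
      by (simp only: e[symmetric] ennreal_mult powr_ge_zero mult_nonneg_nonneg)
    finally show "ennreal (u n) * ?w n * (\<integral>\<^sup>+x\<in>padic_ball l a. ?g n x \<partial>\<mu>)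
        \<le> ennreal (u n) * (ennreal_powr X r * ennreal (?P powr (of_int l * (1 - r / q))))" .
  qed auto
  also have "\<dots> = ennreal (S powr (r - 1)) * ennreal S * (ennreal_powr X r * ennreal (?P powr (of_int l * (1 - r / q))))"
  proof -
    have "(\<Sum>n. ennreal (u n)) = ennreal S"
      unfolding S_def using u su by (intro suminf_ennreal2) (auto intro: less_imp_le)
    then show ?thesis by (simp add: mult.assoc)
  qed
  also have "ennreal (S powr (r - 1)) * ennreal S = ennreal (S powr r)"
    using S by (simp add: powr_diff flip: ennreal_mult')
  also have "ennreal (S powr r) * (ennreal_powr X r * ennreal (?P powr (of_int l * (1 - r / q))))
      = ennreal_powr (ennreal S * X) r * ennreal (?P powr (of_int l * (1 - r / q)))"
    using r S by (simp add: ennreal_powr_cmult mult.assoc)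
  finally show "(\<integral>\<^sup>+x\<in>padic_ball l a. padic_radial (\<lambda>k. ennreal_powr (H k) r) x \<partial>\<mu>)
      \<le> ennreal_powr (ennreal (\<Sum>n. c n * ?P powr (- of_int (sh n) / q)) * X) r * ennreal (?P powr (of_int l * (1 - r / q)))"
    unfolding S_def u_def .
qed

section \<open>Operators with radial kernels\<close>

text \<open>
  If \<open>f\<close> is not integrable on \<open>A\<close>, the Bochner integral takes its default value \<open>0\<close>.
\<close>

lemma cmod_set_integral_le:
  "ennreal (cmod (LINT t:A|\<mu>. f t)) \<le> (\<integral>\<^sup>+t\<in>A. ennreal (cmod (f t)) \<partial>\<mu>)"
proof (cases "set_integrable \<mu> A f")
  case True
  have "ennreal (cmod (LINT t:A|\<mu>. f t)) \<le> (\<integral>\<^sup>+t. ennreal (cmod (indicator A t *\<^sub>R f t)) \<partial>\<mu>)"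
    unfolding set_lebesgue_integral_def
    by (rule integral_norm_bound_ennreal[OF True[unfolded set_integrable_def]])
  also have "\<dots> = (\<integral>\<^sup>+t\<in>A. ennreal (cmod (f t)) \<partial>\<mu>)"
    by (intro nn_integral_cong) (simp add: indicator_def)
  finally show ?thesis .
next
  case False
  then show ?thesis
    by (simp add: set_lebesgue_integral_def set_integrable_def not_integrable_integral_eq)
qed

text \<open>
  The hypothesis bounds \<open>g\<close> by weighted averages of \<open>\<bar>f\<bar>\<close> over spheres. When it is integrated
  over a sphere of level \<open>k - i\<close>, the measure of that sphere cancels the factor \<open>p^(- (k - i))\<close>.
  Exchanging the sums over \<open>i\<close> and \<open>n\<close> then reassembles the spheres of level \<open>k - i + sh n\<close> into the
  ball of level \<open>k + sh n\<close>.
\<close>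

lemma cesaro_level_le_of_sphere_averages:
  fixes g f :: "'p padic \<Rightarrow> complex"
  assumes f: "f \<in> borel_measurable borel" and c: "\<And>n. c n > 0"
    and g: "\<And>k s. s \<in> padic_sphere k \<Longrightarrow> ennreal (cmod (g s)) \<le>
      (\<Sum>n. ennreal (c n * real CARD('p) powr - of_int (k + sh n)) * (\<integral>\<^sup>+t\<in>padic_sphere (k + sh n). ennreal (cmod (f t)) \<partial>\<mu>))"
  shows "cesaro_level \<mu> \<beta> g k \<le>
    (\<Sum>n. ennreal (c n * real CARD('p) powr (- of_int (sh n) * \<beta>)) * cesaro_level \<mu> \<beta> f (k + sh n))"
proof -
  let ?P = "real CARD('p)"
  have P: "?P > 1" by (rule padic_base_gt_1)
  define \<phi> where "\<phi> j = (\<integral>\<^sup>+t\<in>padic_sphere j. ennreal (cmod (f t)) \<partial>\<mu>)" for j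
  have fm: "(\<lambda>t. ennreal (cmod (f t))) \<in> borel_measurable borel"
    by (rule measurable_compose[OF measurable_compose[OF f borel_measurable_norm] measurable_ennreal])
  define h where "h k = (\<Sum>n. ennreal (c n * ?P powr - of_int (k + sh n)) * \<phi> (k + sh n))" for k
  have mass: "(\<integral>\<^sup>+t\<in>padic_ball k 0. ennreal (cmod (g t)) \<partial>\<mu>)
      \<le> (\<Sum>n. ennreal (c n * ?P powr - of_int (sh n)) * (\<integral>\<^sup>+t\<in>padic_ball (k + sh n) 0. ennreal (cmod (f t)) \<partial>\<mu>))"
  proof -
    have "(\<integral>\<^sup>+t\<in>padic_ball k 0. ennreal (cmod (g t)) \<partial>\<mu>) \<le> (\<integral>\<^sup>+t\<in>padic_ball k 0. padic_radial h t \<partial>\<mu>)"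
      using AE_haar_nonzero
    proof (intro nn_integral_mono_AE, eventually_elim)
      case (elim t)
      then have "ennreal (cmod (g t)) \<le> h (padic_level t)"
        using g[of t "padic_level t"] by (simp add: h_def \<phi>_def padic_sphere_def)
      then show ?case using elim by (simp add: padic_radial_def mult_right_mono)
    qed
    also have "\<dots> = (\<Sum>i. h (k - int i) * emeasure \<mu> (padic_sphere (k - int i)))"
      by (rule nn_integral_radial_ball_0)
    also have "\<dots> \<le> (\<Sum>i. \<Sum>n. ennreal (c n * ?P powr - of_int (sh n)) * \<phi> (k + sh n - int i))"
    proof (intro suminf_le summableI)
      fix i
      have "emeasure \<mu> (padic_sphere (k - int i)) \<le> ennreal (?P powr of_int (k - int i))"
        unfolding emeasure_sphere using P by (intro ennreal_leI mult_left_le_one_le) auto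
      then have "h (k - int i) * emeasure \<mu> (padic_sphere (k - int i)) \<le> h (k - int i) * ennreal (?P powr of_int (k - int i))"
        by (rule mult_left_mono) simp
      also have "\<dots> = (\<Sum>n. ennreal (c n * ?P powr - of_int (k - int i + sh n)) * \<phi> (k - int i + sh n) * ennreal (?P powr of_int (k - int i)))"
        unfolding h_def by simp
      also have "\<dots> = (\<Sum>n. ennreal (c n * ?P powr - of_int (sh n)) * \<phi> (k + sh n - int i))"
      proof (intro arg_cong[of _ _ suminf] ext)
        fix n
        have "c n * ?P powr - of_int (k - int i + sh n) * ?P powr of_int (k - int i) = c n * ?P powr - of_int (sh n)"
          by (simp add: mult.assoc flip: powr_add)
        then have "ennreal (c n * ?P powr - of_int (k - int i + sh n)) * ennreal (?P powr of_int (k - int i))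
            = ennreal (c n * ?P powr - of_int (sh n))"
          using ennreal_mult''[of "?P powr of_int (k - int i)" "c n * ?P powr - of_int (k - int i + sh n)"]
          by (simp only: powr_ge_zero)
        moreover have "k - int i + sh n = k + sh n - int i" by simp
        ultimately show "ennreal (c n * ?P powr - of_int (k - int i + sh n)) * \<phi> (k - int i + sh n) * ennreal (?P powr of_int (k - int i))
            = ennreal (c n * ?P powr - of_int (sh n)) * \<phi> (k + sh n - int i)"
          by (simp only: mult_ac)
      qed
      finally show "h (k - int i) * emeasure \<mu> (padic_sphere (k - int i))
          \<le> (\<Sum>n. ennreal (c n * ?P powr - of_int (sh n)) * \<phi> (k + sh n - int i))" .
    qed
    also have "\<dots> = (\<Sum>n. \<Sum>i. ennreal (c n * ?P powr - of_int (sh n)) * \<phi> (k + sh n - int i))"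
      by (rule ennreal_suminf_swap)
    finally show ?thesis by (simp add: nn_integral_ball_spheres[OF fm] \<phi>_def)
  qed
  have "cesaro_level \<mu> \<beta> g k \<le> ennreal (?P powr ((\<beta> - 1) * of_int k)) *
      (\<Sum>n. ennreal (c n * ?P powr - of_int (sh n)) * (\<integral>\<^sup>+t\<in>padic_ball (k + sh n) 0. ennreal (cmod (f t)) \<partial>\<mu>))"
    unfolding cesaro_level_def by (intro mult_left_mono mass) simp
  also have "\<dots> = (\<Sum>n. ennreal (?P powr ((\<beta> - 1) * of_int k)) * (ennreal (c n * ?P powr - of_int (sh n)) *
      (\<integral>\<^sup>+t\<in>padic_ball (k + sh n) 0. ennreal (cmod (f t)) \<partial>\<mu>)))"
    by simp
  also have "\<dots> = (\<Sum>n. ennreal (c n * ?P powr (- of_int (sh n) * \<beta>)) * cesaro_level \<mu> \<beta> f (k + sh n))"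
  proof (intro arg_cong[of _ _ suminf] ext)
    fix n
    have "?P powr ((\<beta> - 1) * of_int k) * (c n * ?P powr - of_int (sh n))
        = c n * (?P powr ((\<beta> - 1) * of_int k) * ?P powr - of_int (sh n))" by simp
    also have "\<dots> = c n * (?P powr (- of_int (sh n) * \<beta>) * ?P powr ((\<beta> - 1) * of_int (k + sh n)))"
      unfolding powr_add[symmetric] by (simp add: algebra_simps)
    finally have "?P powr ((\<beta> - 1) * of_int k) * (c n * ?P powr - of_int (sh n))
        = (c n * ?P powr (- of_int (sh n) * \<beta>)) * ?P powr ((\<beta> - 1) * of_int (k + sh n))" by simp
    then have "ennreal (?P powr ((\<beta> - 1) * of_int k)) * ennreal (c n * ?P powr - of_int (sh n))
        = ennreal (c n * ?P powr (- of_int (sh n) * \<beta>)) * ennreal (?P powr ((\<beta> - 1) * of_int (k + sh n)))"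
      using ennreal_mult'[of "?P powr ((\<beta> - 1) * of_int k)" "c n * ?P powr - of_int (sh n)"]
        ennreal_mult''[of "?P powr ((\<beta> - 1) * of_int (k + sh n))" "c n * ?P powr (- of_int (sh n) * \<beta>)"]
      by (simp only: powr_ge_zero)
    then show "ennreal (?P powr ((\<beta> - 1) * of_int k)) * (ennreal (c n * ?P powr - of_int (sh n)) *
          (\<integral>\<^sup>+t\<in>padic_ball (k + sh n) 0. ennreal (cmod (f t)) \<partial>\<mu>))
        = ennreal (c n * ?P powr (- of_int (sh n) * \<beta>)) * cesaro_level \<mu> \<beta> f (k + sh n)"
      unfolding cesaro_level_def by (simp only: mult.assoc[symmetric])
  qed
  finally show ?thesis .
qed

text \<open>
  The common part of both estimates. The operator is dominated on each sphere by a constant \<open>h\<close>,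
  which controls its Cesaro average by the sequence \<open>H\<close>, a weighted sum of shifts of that of \<open>f\<close>.
  The bound for \<open>H\<close> also gives absolute convergence: it makes \<open>H\<close> finite, and \<open>h\<close> is finite with
  it because a sphere carries at most the mass of the ball around it.
\<close>

lemma radial_kernel_operator_bound:
  fixes w :: "'p padic \<Rightarrow> real" and L :: "'p padic \<Rightarrow> 'p padic \<Rightarrow> real" and D :: "'p padic \<Rightarrow> 'p padic set"
    and f :: "'p padic \<Rightarrow> complex"
  assumes r: "r \<ge> 1" and q: "q > 0" and f: "f \<in> cesaro_morrey \<mu> \<beta> r q"
    and sh: "inj sh" and c: "\<And>n. c n > 0"
    and sm: "summable (\<lambda>n. c n * real CARD('p) powr (- of_int (sh n) * (\<beta> + 1 / q)))"
    and D: "\<And>s. s \<noteq> 0 \<Longrightarrow> D s = (\<Union>n. padic_sphere (padic_level s + sh n))"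
    and L: "\<And>s. L s \<in> borel_measurable borel" and w: "\<And>s. s \<noteq> 0 \<Longrightarrow> w s \<noteq> 0"
    and wL: "\<And>s t n. s \<noteq> 0 \<Longrightarrow> t \<in> padic_sphere (padic_level s + sh n) \<Longrightarrow>
      \<bar>w s\<bar> * \<bar>L s t\<bar> \<le> c n * real CARD('p) powr - of_int (padic_level s + sh n)"
  shows "(\<forall>s. s \<noteq> 0 \<longrightarrow> set_integrable \<mu> (D s) (\<lambda>t. complex_of_real (L s t) * f t)) \<and>
    cesaro_morrey_norm \<mu> \<beta> r q (\<lambda>s. complex_of_real (w s) * (LINT t:D s|\<mu>. complex_of_real (L s t) * f t))
      \<le> ennreal (\<Sum>n. c n * real CARD('p) powr (- of_int (sh n) * (\<beta> + 1 / q))) * cesaro_morrey_norm \<mu> \<beta> r q f"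
proof -
  let ?P = "real CARD('p)"
  let ?N = "cesaro_morrey_norm \<mu> \<beta> r q f"
  let ?T = "\<lambda>s. complex_of_real (w s) * (LINT t:D s|\<mu>. complex_of_real (L s t) * f t)"
  have P: "?P > 1" by (rule padic_base_gt_1)
  have r0: "r > 0" using r by simp
  have fin: "?N < \<infinity>" using f by (simp add: cesaro_morrey_def)
  have fm: "f \<in> borel_measurable borel"
    using f measurable_cong_sets[OF sets_haar refl]
    by (auto simp: cesaro_morrey_def locally_integrable_def)
  have fe: "(\<lambda>t. ennreal (cmod (f t))) \<in> borel_measurable borel"
    by (rule measurable_compose[OF measurable_compose[OF fm borel_measurable_norm] measurable_ennreal])
  define \<phi> where "\<phi> j = (\<integral>\<^sup>+t\<in>padic_sphere j. ennreal (cmod (f t)) \<partial>\<mu>)" for j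
  define h where "h k = (\<Sum>n. ennreal (c n * ?P powr - of_int (k + sh n)) * \<phi> (k + sh n))" for k
  define H where "H k = (\<Sum>n. ennreal (c n * ?P powr (- of_int (sh n) * \<beta>)) * cesaro_level \<mu> \<beta> f (k + sh n))" for k
  have sm': "c n * ?P powr (- of_int (sh n) * \<beta>) * ?P powr (- of_int (sh n) / q)
      = c n * ?P powr (- of_int (sh n) * (\<beta> + 1 / q))" for n
    by (simp add: mult.assoc distrib_left flip: powr_add)
  have "morrey_bound r q (cesaro_level \<mu> \<beta> f) ?N"
    using cesaro_morrey_norm_le_iff[OF r0 q] by auto
  from morrey_bound_shift_sum[OF r q this, where c = "\<lambda>n. c n * ?P powr (- of_int (sh n) * \<beta>)" and sh = sh and H = H]
  have H: "morrey_bound r q H (ennreal (\<Sum>n. c n * ?P powr (- of_int (sh n) * (\<beta> + 1 / q))) * ?N)"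
    unfolding sm' using c P sm by (simp add: H_def)
  have "ennreal (\<Sum>n. c n * ?P powr (- of_int (sh n) * (\<beta> + 1 / q))) * ?N < \<infinity>"
    using fin by (simp add: ennreal_mult_less_top)
  from morrey_bound_finite[OF H this r0] have Hfin: "H k < \<infinity>" for k .
  have kernel: "ennreal \<bar>w s\<bar> * (\<integral>\<^sup>+t\<in>D s. ennreal (cmod (complex_of_real (L s t) * f t)) \<partial>\<mu>) \<le> h (padic_level s)"
    if s: "s \<noteq> 0" for s
  proof -
    have Lf: "(\<lambda>t. ennreal (\<bar>L s t\<bar> * cmod (f t))) \<in> borel_measurable borel"
      by (intro measurable_compose[OF _ measurable_ennreal] borel_measurable_times borel_measurable_abs L
          measurable_compose[OF fm borel_measurable_norm])
    have "ennreal \<bar>w s\<bar> * (\<integral>\<^sup>+t\<in>D s. ennreal (cmod (complex_of_real (L s t) * f t)) \<partial>\<mu>)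
        = ennreal \<bar>w s\<bar> * (\<Sum>n. \<integral>\<^sup>+t\<in>padic_sphere (padic_level s + sh n). ennreal (\<bar>L s t\<bar> * cmod (f t)) \<partial>\<mu>)"
      using sh by (simp add: D[OF s] norm_mult nn_integral_spheres[OF Lf] inj_def)
    also have "\<dots> = (\<Sum>n. ennreal \<bar>w s\<bar> * (\<integral>\<^sup>+t\<in>padic_sphere (padic_level s + sh n). ennreal (\<bar>L s t\<bar> * cmod (f t)) \<partial>\<mu>))"
      by simp
    also have "\<dots> \<le> h (padic_level s)"
      unfolding h_def
    proof (intro suminf_le summableI)
      fix n
      let ?S = "padic_sphere (padic_level s + sh n) :: 'p padic set"
      let ?b = "c n * ?P powr - of_int (padic_level s + sh n)"
      have "ennreal \<bar>w s\<bar> * (\<integral>\<^sup>+t\<in>?S. ennreal (\<bar>L s t\<bar> * cmod (f t)) \<partial>\<mu>)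
          = (\<integral>\<^sup>+t. ennreal \<bar>w s\<bar> * (ennreal (\<bar>L s t\<bar> * cmod (f t)) * indicator ?S t) \<partial>\<mu>)"
        by (intro nn_integral_cmult[symmetric] borel_measurable_haar_restrict Lf padic_sphere_borel)
      also have "\<dots> \<le> (\<integral>\<^sup>+t. ennreal ?b * (ennreal (cmod (f t)) * indicator ?S t) \<partial>\<mu>)"
      proof (intro nn_integral_mono)
        fix t
        show "ennreal \<bar>w s\<bar> * (ennreal (\<bar>L s t\<bar> * cmod (f t)) * indicator ?S t)
            \<le> ennreal ?b * (ennreal (cmod (f t)) * indicator ?S t)"
        proof (cases "t \<in> ?S")
          case True
          have "\<bar>w s\<bar> * (\<bar>L s t\<bar> * cmod (f t)) \<le> ?b * cmod (f t)"
            using mult_right_mono[OF wL[OF s True], of "cmod (f t)"] by (simp add: mult.assoc)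
          then have "ennreal (\<bar>w s\<bar> * (\<bar>L s t\<bar> * cmod (f t))) \<le> ennreal (?b * cmod (f t))" by (rule ennreal_leI)
          then have "ennreal \<bar>w s\<bar> * ennreal (\<bar>L s t\<bar> * cmod (f t)) \<le> ennreal ?b * ennreal (cmod (f t))"
            using ennreal_mult'[of "\<bar>w s\<bar>" "\<bar>L s t\<bar> * cmod (f t)"] ennreal_mult''[of "cmod (f t)" ?b] by simp
          then show ?thesis using True by simp
        qed simp
      qed
      also have "\<dots> = ennreal ?b * \<phi> (padic_level s + sh n)"
        unfolding \<phi>_def by (intro nn_integral_cmult borel_measurable_haar_restrict fe padic_sphere_borel)
      finally show "ennreal \<bar>w s\<bar> * (\<integral>\<^sup>+t\<in>?S. ennreal (\<bar>L s t\<bar> * cmod (f t)) \<partial>\<mu>) \<le> ennreal ?b * \<phi> (padic_level s + sh n)" .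
    qed
    finally show ?thesis .
  qed
  have hH: "ennreal (?P powr (\<beta> * of_int k)) * h k \<le> H k" for k
  proof -
    have "ennreal (?P powr (\<beta> * of_int k)) * h k
        = (\<Sum>n. ennreal (?P powr (\<beta> * of_int k)) * (ennreal (c n * ?P powr - of_int (k + sh n)) * \<phi> (k + sh n)))"
      by (simp add: h_def)
    also have "\<dots> \<le> H k"
      unfolding H_def
    proof (intro suminf_le summableI)
      fix n
      have le: "\<phi> (k + sh n) \<le> (\<integral>\<^sup>+t\<in>padic_ball (k + sh n) 0. ennreal (cmod (f t)) \<partial>\<mu>)"
        unfolding \<phi>_def
        by (intro nn_integral_mono mult_left_mono) (auto simp: indicator_def mem_padic_ball_0 padic_sphere_def)
      have "?P powr (\<beta> * of_int k) * (c n * ?P powr - of_int (k + sh n))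
          = c n * (?P powr (\<beta> * of_int k) * ?P powr - of_int (k + sh n))" by simp
      also have "\<dots> = c n * (?P powr (- of_int (sh n) * \<beta>) * ?P powr ((\<beta> - 1) * of_int (k + sh n)))"
        unfolding powr_add[symmetric] by (simp add: algebra_simps)
      finally have "?P powr (\<beta> * of_int k) * (c n * ?P powr - of_int (k + sh n))
          = c n * ?P powr (- of_int (sh n) * \<beta>) * ?P powr ((\<beta> - 1) * of_int (k + sh n))" by simp
      then have e: "ennreal (?P powr (\<beta> * of_int k)) * ennreal (c n * ?P powr - of_int (k + sh n))
          = ennreal (c n * ?P powr (- of_int (sh n) * \<beta>)) * ennreal (?P powr ((\<beta> - 1) * of_int (k + sh n)))"
        using ennreal_mult'[of "?P powr (\<beta> * of_int k)" "c n * ?P powr - of_int (k + sh n)"]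
          ennreal_mult''[of "?P powr ((\<beta> - 1) * of_int (k + sh n))" "c n * ?P powr (- of_int (sh n) * \<beta>)"]
        by (simp only: powr_ge_zero)
      show "ennreal (?P powr (\<beta> * of_int k)) * (ennreal (c n * ?P powr - of_int (k + sh n)) * \<phi> (k + sh n))
          \<le> ennreal (c n * ?P powr (- of_int (sh n) * \<beta>)) * cesaro_level \<mu> \<beta> f (k + sh n)"
        unfolding cesaro_level_def mult.assoc[symmetric] e by (intro mult_left_mono le) simp
    qed
    finally show ?thesis .
  qed
  have hfin: "h k < \<infinity>" for k
  proof -
    have "ennreal (?P powr (\<beta> * of_int k)) * h k < \<infinity>" using hH Hfin by (rule le_less_trans)
    moreover have "ennreal (?P powr (\<beta> * of_int k)) \<noteq> 0" using P by simp
    ultimately show ?thesis by (auto simp: ennreal_mult_less_top)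
  qed
  have integrable: "set_integrable \<mu> (D s) (\<lambda>t. complex_of_real (L s t) * f t)" if s: "s \<noteq> 0" for s
  proof -
    have DB: "D s \<in> sets borel" unfolding D[OF s] by (intro sets.countable_UN) (auto simp: padic_sphere_borel)
    have "(\<lambda>t. complex_of_real (L s t) * f t) \<in> borel_measurable borel"
      by (intro borel_measurable_times measurable_compose[OF L borel_measurable_of_real] fm)
    then have "(\<lambda>t. indicator (D s) t *\<^sub>R (complex_of_real (L s t) * f t)) \<in> borel_measurable borel"
      by (intro borel_measurable_scaleR borel_measurable_indicator DB)
    then have m: "(\<lambda>t. indicator (D s) t *\<^sub>R (complex_of_real (L s t) * f t)) \<in> borel_measurable \<mu>"
      unfolding measurable_cong_sets[OF sets_haar refl] .
    have "ennreal \<bar>w s\<bar> * (\<integral>\<^sup>+t\<in>D s. ennreal (cmod (complex_of_real (L s t) * f t)) \<partial>\<mu>) < \<infinity>"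
      using kernel[OF s] hfin by (rule le_less_trans)
    moreover have "ennreal \<bar>w s\<bar> \<noteq> 0" using w[OF s] by simp
    ultimately have "(\<integral>\<^sup>+t\<in>D s. ennreal (cmod (complex_of_real (L s t) * f t)) \<partial>\<mu>) < \<infinity>"
      by (auto simp: ennreal_mult_less_top)
    also have "(\<integral>\<^sup>+t\<in>D s. ennreal (cmod (complex_of_real (L s t) * f t)) \<partial>\<mu>)
        = (\<integral>\<^sup>+t. ennreal (norm (indicator (D s) t *\<^sub>R (complex_of_real (L s t) * f t))) \<partial>\<mu>)"
      by (intro nn_integral_cong) (simp add: indicator_def)
    finally show ?thesis
      unfolding set_integrable_def using m by (intro integrableI_bounded) auto
  qed
  have "ennreal (cmod (?T s)) \<le> h k" if "s \<in> padic_sphere k" for s k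
  proof -
    have s: "s \<noteq> 0" "k = padic_level s" using that by (auto simp: padic_sphere_def)
    have "ennreal (cmod (?T s)) = ennreal \<bar>w s\<bar> * ennreal (cmod (LINT t:D s|\<mu>. complex_of_real (L s t) * f t))"
      by (simp add: norm_mult ennreal_mult)
    also have "\<dots> \<le> ennreal \<bar>w s\<bar> * (\<integral>\<^sup>+t\<in>D s. ennreal (cmod (complex_of_real (L s t) * f t)) \<partial>\<mu>)"
      by (intro mult_left_mono cmod_set_integral_le) simp
    finally show ?thesis using kernel[OF s(1)] s(2) by simp
  qed
  then have level: "cesaro_level \<mu> \<beta> ?T k \<le> H k" for k
    unfolding H_def h_def \<phi>_def by (intro cesaro_level_le_of_sphere_averages fm c)
  have "morrey_bound r q (cesaro_level \<mu> \<beta> ?T) (ennreal (\<Sum>n. c n * ?P powr (- of_int (sh n) * (\<beta> + 1 / q))) * ?N)"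
    by (rule morrey_bound_mono[OF H r0 level])
  then have "cesaro_morrey_norm \<mu> \<beta> r q ?T \<le> ennreal (\<Sum>n. c n * ?P powr (- of_int (sh n) * (\<beta> + 1 / q))) * ?N"
    unfolding cesaro_morrey_norm_le_iff[OF r0 q] .
  then show ?thesis using integrable by blast
qed

end

section \<open>The Erdelyi-Kober kernels\<close>

text \<open>
  Since \<open>j < k\<close> are integers, the quotient of the difference by \<open>P^(\<nu> k)\<close> lies between
  \<open>1 - P^(- \<nu>) > 0\<close> and \<open>1\<close>. This is where discreteness of the value group removes the
  singularity of the kernel for \<open>\<delta> < 1\<close>.
\<close>

lemma powr_gap_le:
  fixes P \<nu> \<delta> :: real and j k :: int
  assumes P: "P > 1" and \<nu>: "\<nu> > 0" and jk: "j < k"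
  shows "(P powr (\<nu> * of_int k) - P powr (\<nu> * of_int j)) powr (\<delta> - 1)
    \<le> max 1 ((1 - P powr - \<nu>) powr (\<delta> - 1)) * P powr (\<nu> * of_int k * (\<delta> - 1))"
proof -
  define y where "y = 1 - P powr (- \<nu> * of_int (k - j))"
  have "P powr (- \<nu> * of_int (k - j)) \<le> P powr - \<nu>"
    using P \<nu> jk by (intro powr_mono) (auto simp: mult_le_cancel_left1)
  moreover have "P powr - \<nu> < 1" using P \<nu> by (simp add: powr_less_one)
  ultimately have y: "1 - P powr - \<nu> \<le> y" "0 < 1 - P powr - \<nu>" "y \<le> 1" by (auto simp: y_def)
  have "P powr (\<nu> * of_int j) = P powr (\<nu> * of_int k) * P powr (- \<nu> * of_int (k - j))"
    by (simp add: algebra_simps flip: powr_add)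
  then have "P powr (\<nu> * of_int k) - P powr (\<nu> * of_int j) = y * P powr (\<nu> * of_int k)"
    by (simp add: y_def algebra_simps)
  then have "(P powr (\<nu> * of_int k) - P powr (\<nu> * of_int j)) powr (\<delta> - 1)
      = y powr (\<delta> - 1) * P powr (\<nu> * of_int k * (\<delta> - 1))"
    using y by (simp add: powr_mult powr_powr)
  also have "y powr (\<delta> - 1) \<le> max 1 ((1 - P powr - \<nu>) powr (\<delta> - 1))"
  proof (cases "\<delta> \<ge> 1")
    case True
    then have "y powr (\<delta> - 1) \<le> 1 powr (\<delta> - 1)" using y by (intro powr_mono2) auto
    then show ?thesis by simp
  next
    case False
    then have "y powr (\<delta> - 1) \<le> (1 - P powr - \<nu>) powr (\<delta> - 1)" using y by (intro powr_mono2') auto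
    then show ?thesis by simp
  qed
  finally show ?thesis by (simp add: mult_right_mono)
qed

lemma summable_geometric_powr:
  assumes "P > 1" "e > 0"
  shows "summable (\<lambda>n. C * P powr (- (real n + 1) * e))"
proof -
  have "P powr (- (real n + 1) * e) = P powr - e * (P powr - e) ^ n" for n
    using assms by (simp add: algebra_simps powr_powr flip: powr_add powr_realpow)
  moreover have "\<bar>P powr - e\<bar> < 1" using assms by (simp add: powr_less_one)
  ultimately show ?thesis by (simp add: summable_mult summable_geometric)
qed

lemma EK1_domain_eq_spheres:
  fixes s :: "'p::prime_card padic"
  assumes "s \<noteq> 0"
  shows "EK1_domain s = (\<Union>n. padic_sphere (padic_level s + (- 1 - int n)))"
proof -
  have iff: "i < j \<longleftrightarrow> (\<exists>n. i = j + (- 1 - int n))" for i j :: int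
  proof
    assume "i < j"
    then have "i = j + (- 1 - int (nat (j - i - 1)))" by simp
    then show "\<exists>n. i = j + (- 1 - int n)" ..
  qed auto
  have "padic_abs t < padic_abs s \<longleftrightarrow> t = 0 \<or> padic_level t < padic_level s" for t :: "'p padic"
    unfolding padic_abs_eq_level[OF assms] by (rule padic_abs_less_iff)
  then show ?thesis by (auto simp: EK1_domain_def padic_sphere_def iff)
qed

lemma EK2_domain_eq_spheres:
  fixes s :: "'p::prime_card padic"
  assumes "s \<noteq> 0"
  shows "EK2_domain s = (\<Union>n. padic_sphere (padic_level s + (1 + int n)))"
proof -
  have iff: "\<not> j \<le> i \<longleftrightarrow> (\<exists>n. j = i + (1 + int n))" for i j :: int
  proof
    assume "\<not> j \<le> i"
    then have "j = i + (1 + int (nat (j - i - 1)))" by simp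
    then show "\<exists>n. j = i + (1 + int n)" ..
  qed auto
  have "padic_abs s < padic_abs t \<longleftrightarrow> \<not> (t = 0 \<or> padic_level t \<le> padic_level s)" for t :: "'p padic"
    unfolding padic_abs_eq_level[OF assms] by (simp only: not_le[symmetric] padic_abs_le_iff)
  then show ?thesis by (auto simp: EK2_domain_def padic_sphere_def iff simp del: not_le)
qed

lemma EK_kernel_measurable:
  "(\<lambda>t. padic_abs (t :: 'p::prime_card padic) powr a * (padic_abs t powr \<nu> - x) powr d) \<in> borel_measurable borel"
  "(\<lambda>t. padic_abs (t :: 'p::prime_card padic) powr a * (x - padic_abs t powr \<nu>) powr d) \<in> borel_measurable borel"
proof -
  have *: "(\<lambda>y::real. y powr a * (y powr \<nu> - x) powr d) \<in> borel_measurable borel"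
    "(\<lambda>y::real. y powr a * (x - y powr \<nu>) powr d) \<in> borel_measurable borel" by measurable
  from *[THEN measurable_compose[OF padic_abs_measurable]]
  show "(\<lambda>t. padic_abs (t :: 'p::prime_card padic) powr a * (padic_abs t powr \<nu> - x) powr d) \<in> borel_measurable borel"
    "(\<lambda>t. padic_abs (t :: 'p::prime_card padic) powr a * (x - padic_abs t powr \<nu>) powr d) \<in> borel_measurable borel"
    by simp_all
qed

text \<open>
  Here \<open>x\<close> and \<open>y\<close> stand for the absolute values of \<open>s\<close> and \<open>t\<close>. After the difference is replaced
  by \<open>P^(\<nu> k (\<delta> - 1))\<close>, the parameter \<open>\<delta>\<close> disappears from the exponent. Factoring out one power of
  \<open>1 / y\<close>, the inverse measure of the sphere of \<open>t\<close> up to a constant, leaves a geometric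
  decay in the distance of the levels.
\<close>

lemma EK1_kernel_bound:
  fixes P \<nu> \<gamma> \<delta> :: real and k :: int and n :: nat
  assumes P: "P > 1" and \<nu>: "\<nu> > 0" and \<delta>: "\<delta> > 0"
    and x: "x = P powr of_int k" and y: "y = P powr of_int (k + (- 1 - int n))"
  shows "\<bar>x powr (- \<nu> * (\<gamma> + \<delta>)) / Gamma \<delta>\<bar> * \<bar>y powr (\<nu> * (\<gamma> + 1) - 1) * (x powr \<nu> - y powr \<nu>) powr (\<delta> - 1)\<bar>
    \<le> (max 1 ((1 - P powr - \<nu>) powr (\<delta> - 1)) / Gamma \<delta> * P powr (- (real n + 1) * (\<nu> * (\<gamma> + 1))))
      * P powr - of_int (k + (- 1 - int n))"
proof -
  let ?M = "max 1 ((1 - P powr - \<nu>) powr (\<delta> - 1))"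
  let ?j = "k + (- 1 - int n)"
  have G: "Gamma \<delta> > 0" using \<delta> by (rule Gamma_real_pos)
  have "\<bar>x powr (- \<nu> * (\<gamma> + \<delta>)) / Gamma \<delta>\<bar> * \<bar>y powr (\<nu> * (\<gamma> + 1) - 1) * (x powr \<nu> - y powr \<nu>) powr (\<delta> - 1)\<bar>
      = x powr (- \<nu> * (\<gamma> + \<delta>)) * y powr (\<nu> * (\<gamma> + 1) - 1) / Gamma \<delta> * (x powr \<nu> - y powr \<nu>) powr (\<delta> - 1)"
    using G by (simp add: abs_mult)
  also have "\<dots> \<le> x powr (- \<nu> * (\<gamma> + \<delta>)) * y powr (\<nu> * (\<gamma> + 1) - 1) / Gamma \<delta> * (?M * P powr (\<nu> * of_int k * (\<delta> - 1)))"
    using powr_gap_le[OF P \<nu>, of ?j k \<delta>] G unfolding x y powr_powr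
    by (intro mult_left_mono) (auto simp: mult.commute)
  also have "\<dots> = ?M / Gamma \<delta> * (P powr (of_int k * (- \<nu> * (\<gamma> + \<delta>))) * P powr (of_int ?j * (\<nu> * (\<gamma> + 1) - 1))
      * P powr (\<nu> * of_int k * (\<delta> - 1)))"
    unfolding x y powr_powr by simp
  also have "\<dots> = ?M / Gamma \<delta> * (P powr (- (real n + 1) * (\<nu> * (\<gamma> + 1))) * P powr - of_int ?j)"
    unfolding powr_add[symmetric] by (simp add: algebra_simps)
  finally show ?thesis by (simp only: mult.assoc)
qed

text \<open>
  As for the first kind, except that the larger absolute value is now that of \<open>t\<close>.
\<close>

lemma EK2_kernel_bound:
  fixes P \<nu> \<gamma> \<delta> :: real and k :: int and n :: nat
  assumes P: "P > 1" and \<nu>: "\<nu> > 0" and \<delta>: "\<delta> > 0"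
    and x: "x = P powr of_int k" and y: "y = P powr of_int (k + (1 + int n))"
  shows "\<bar>x powr (\<nu> * \<gamma>) / Gamma \<delta>\<bar> * \<bar>y powr (- \<nu> * (\<gamma> + \<delta>) + \<nu> - 1) * (y powr \<nu> - x powr \<nu>) powr (\<delta> - 1)\<bar>
    \<le> (max 1 ((1 - P powr - \<nu>) powr (\<delta> - 1)) / Gamma \<delta> * P powr (- (real n + 1) * (\<nu> * \<gamma>)))
      * P powr - of_int (k + (1 + int n))"
proof -
  let ?M = "max 1 ((1 - P powr - \<nu>) powr (\<delta> - 1))"
  let ?j = "k + (1 + int n)"
  have G: "Gamma \<delta> > 0" using \<delta> by (rule Gamma_real_pos)
  have "\<bar>x powr (\<nu> * \<gamma>) / Gamma \<delta>\<bar> * \<bar>y powr (- \<nu> * (\<gamma> + \<delta>) + \<nu> - 1) * (y powr \<nu> - x powr \<nu>) powr (\<delta> - 1)\<bar>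
      = x powr (\<nu> * \<gamma>) * y powr (- \<nu> * (\<gamma> + \<delta>) + \<nu> - 1) / Gamma \<delta> * (y powr \<nu> - x powr \<nu>) powr (\<delta> - 1)"
    using G by (simp add: abs_mult)
  also have "\<dots> \<le> x powr (\<nu> * \<gamma>) * y powr (- \<nu> * (\<gamma> + \<delta>) + \<nu> - 1) / Gamma \<delta> * (?M * P powr (\<nu> * of_int ?j * (\<delta> - 1)))"
    using powr_gap_le[OF P \<nu>, of k ?j \<delta>] G unfolding x y powr_powr
    by (intro mult_left_mono) (auto simp: mult.commute)
  also have "\<dots> = ?M / Gamma \<delta> * (P powr (of_int k * (\<nu> * \<gamma>)) * P powr (of_int ?j * (- \<nu> * (\<gamma> + \<delta>) + \<nu> - 1))
      * P powr (\<nu> * of_int ?j * (\<delta> - 1)))"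
    unfolding x y powr_powr by simp
  also have "\<dots> = ?M / Gamma \<delta> * (P powr (- (real n + 1) * (\<nu> * \<gamma>)) * P powr - of_int ?j)"
    unfolding powr_add[symmetric] by (simp add: algebra_simps)
  finally show ?thesis by (simp only: mult.assoc)
qed

theorem theorem19:
  fixes \<mu> :: "'p::prime_card padic measure"
    and r q \<delta> \<nu> \<gamma> \<beta> :: real
  assumes haar: "normalized_haar \<mu>"
    and "1 \<le> r" and "r \<le> q"
    and "\<delta> > 0" and "\<nu> > 0"
    and "0 \<le> \<beta>" and "\<beta> < 1"
  shows "(\<nu> * (\<gamma> + 1) > \<beta> + 1 / q \<longrightarrow>
            (\<exists>C>0. \<forall>f\<in>cesaro_morrey \<mu> \<beta> r q.
               (\<forall>s. s \<noteq> 0 \<longrightarrow> set_integrable \<mu> (EK1_domain s) (EK1_integrand \<nu> \<gamma> \<delta> f s)) \<and>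
               cesaro_morrey_norm \<mu> \<beta> r q (EK1 \<mu> \<nu> \<gamma> \<delta> f)
                 \<le> ennreal C * cesaro_morrey_norm \<mu> \<beta> r q f))
       \<and> (\<nu> * \<gamma> + \<beta> > - (1 / q) \<longrightarrow>
            (\<exists>C>0. \<forall>f\<in>cesaro_morrey \<mu> \<beta> r q.
               (\<forall>s. s \<noteq> 0 \<longrightarrow> set_integrable \<mu> (EK2_domain s) (EK2_integrand \<nu> \<gamma> \<delta> f s)) \<and>
               cesaro_morrey_norm \<mu> \<beta> r q (EK2 \<mu> \<nu> \<gamma> \<delta> f)
                 \<le> ennreal C * cesaro_morrey_norm \<mu> \<beta> r q f))"
proof -
  interpret padic_haar \<mu> by unfold_locales (rule haar)
  let ?P = "real CARD('p)"
  define M where "M = max 1 ((1 - ?P powr - \<nu>) powr (\<delta> - 1)) / Gamma \<delta>"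
  have P: "?P > 1" by (rule padic_base_gt_1)
  have q: "q > 0" using assms by simp
  have G: "Gamma \<delta> > 0" using \<open>\<delta> > 0\<close> by (rule Gamma_real_pos)
  have M: "M > 0" unfolding M_def using G by (intro divide_pos_pos) auto
  have level: "padic_abs t = ?P powr of_int k" if "t \<in> padic_sphere k" for t :: "'p padic" and k
    using that padic_abs_eq_level[of t] by (auto simp: padic_sphere_def)
  show ?thesis
  proof (intro conjI impI)
    assume gap: "\<nu> * (\<gamma> + 1) > \<beta> + 1 / q"
    define c where "c n = M * ?P powr (- (real n + 1) * (\<nu> * (\<gamma> + 1)))" for n
    define sh where "sh n = - 1 - int n" for n
    have c: "c n > 0" for n using M P by (simp add: c_def)
    have "c n * ?P powr (- of_int (sh n) * (\<beta> + 1 / q))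
        = M * ?P powr (- (real n + 1) * (\<nu> * (\<gamma> + 1) - (\<beta> + 1 / q)))" for n
      unfolding c_def sh_def mult.assoc powr_add[symmetric] by (simp add: algebra_simps)
    then have sm: "summable (\<lambda>n. c n * ?P powr (- of_int (sh n) * (\<beta> + 1 / q)))"
      using summable_geometric_powr[OF P, of "\<nu> * (\<gamma> + 1) - (\<beta> + 1 / q)" M] gap by simp
    have "0 < (\<Sum>n. c n * ?P powr (- of_int (sh n) * (\<beta> + 1 / q)))"
      using c P by (intro suminf_pos sm) simp
    moreover have "(\<forall>s. s \<noteq> 0 \<longrightarrow> set_integrable \<mu> (EK1_domain s) (EK1_integrand \<nu> \<gamma> \<delta> f s)) \<and>
        cesaro_morrey_norm \<mu> \<beta> r q (EK1 \<mu> \<nu> \<gamma> \<delta> f)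
          \<le> ennreal (\<Sum>n. c n * ?P powr (- of_int (sh n) * (\<beta> + 1 / q))) * cesaro_morrey_norm \<mu> \<beta> r q f"
      if f: "f \<in> cesaro_morrey \<mu> \<beta> r q" for f
      unfolding EK1_def[abs_def] EK1_integrand_def[abs_def]
    proof (rule radial_kernel_operator_bound[OF \<open>1 \<le> r\<close> q f _ c sm])
      show "inj sh" by (simp add: inj_def sh_def)
    next
      fix s :: "'p padic" assume s: "s \<noteq> 0"
      show "EK1_domain s = (\<Union>n. padic_sphere (padic_level s + sh n))"
        unfolding sh_def by (rule EK1_domain_eq_spheres[OF s])
      show "padic_abs s powr (- \<nu> * (\<gamma> + \<delta>)) / Gamma \<delta> \<noteq> 0" using s G by simp
      fix t :: "'p padic" and n assume "t \<in> padic_sphere (padic_level s + sh n)"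
      from level[OF this] show "\<bar>padic_abs s powr (- \<nu> * (\<gamma> + \<delta>)) / Gamma \<delta>\<bar> * \<bar>padic_abs t powr (\<nu> * (\<gamma> + 1) - 1) * (padic_abs s powr \<nu> - padic_abs t powr \<nu>) powr (\<delta> - 1)\<bar>
          \<le> c n * ?P powr - of_int (padic_level s + sh n)"
        unfolding c_def M_def sh_def
        by (intro EK1_kernel_bound[OF P \<open>\<nu> > 0\<close> \<open>\<delta> > 0\<close>] padic_abs_eq_level[OF s])
    qed (rule EK_kernel_measurable)
    ultimately show "\<exists>C>0. \<forall>f\<in>cesaro_morrey \<mu> \<beta> r q.
               (\<forall>s. s \<noteq> 0 \<longrightarrow> set_integrable \<mu> (EK1_domain s) (EK1_integrand \<nu> \<gamma> \<delta> f s)) \<and>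
               cesaro_morrey_norm \<mu> \<beta> r q (EK1 \<mu> \<nu> \<gamma> \<delta> f)
                 \<le> ennreal C * cesaro_morrey_norm \<mu> \<beta> r q f"
      by blast
  next
    assume gap: "\<nu> * \<gamma> + \<beta> > - (1 / q)"
    define c where "c n = M * ?P powr (- (real n + 1) * (\<nu> * \<gamma>))" for n
    define sh where "sh n = 1 + int n" for n
    have c: "c n > 0" for n using M P by (simp add: c_def)
    have "c n * ?P powr (- of_int (sh n) * (\<beta> + 1 / q))
        = M * ?P powr (- (real n + 1) * (\<nu> * \<gamma> + \<beta> + 1 / q))" for n
      unfolding c_def sh_def mult.assoc powr_add[symmetric] by (simp add: algebra_simps)
    then have sm: "summable (\<lambda>n. c n * ?P powr (- of_int (sh n) * (\<beta> + 1 / q)))"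
      using summable_geometric_powr[OF P, of "\<nu> * \<gamma> + \<beta> + 1 / q" M] gap by simp
    have "0 < (\<Sum>n. c n * ?P powr (- of_int (sh n) * (\<beta> + 1 / q)))"
      using c P by (intro suminf_pos sm) simp
    moreover have "(\<forall>s. s \<noteq> 0 \<longrightarrow> set_integrable \<mu> (EK2_domain s) (EK2_integrand \<nu> \<gamma> \<delta> f s)) \<and>
        cesaro_morrey_norm \<mu> \<beta> r q (EK2 \<mu> \<nu> \<gamma> \<delta> f)
          \<le> ennreal (\<Sum>n. c n * ?P powr (- of_int (sh n) * (\<beta> + 1 / q))) * cesaro_morrey_norm \<mu> \<beta> r q f"
      if f: "f \<in> cesaro_morrey \<mu> \<beta> r q" for f
      unfolding EK2_def[abs_def] EK2_integrand_def[abs_def]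
    proof (rule radial_kernel_operator_bound[OF \<open>1 \<le> r\<close> q f _ c sm])
      show "inj sh" by (simp add: inj_def sh_def)
    next
      fix s :: "'p padic" assume s: "s \<noteq> 0"
      show "EK2_domain s = (\<Union>n. padic_sphere (padic_level s + sh n))"
        unfolding sh_def by (rule EK2_domain_eq_spheres[OF s])
      show "padic_abs s powr (\<nu> * \<gamma>) / Gamma \<delta> \<noteq> 0" using s G by simp
      fix t :: "'p padic" and n assume "t \<in> padic_sphere (padic_level s + sh n)"
      from level[OF this] show "\<bar>padic_abs s powr (\<nu> * \<gamma>) / Gamma \<delta>\<bar> * \<bar>padic_abs t powr (- \<nu> * (\<gamma> + \<delta>) + \<nu> - 1) * (padic_abs t powr \<nu> - padic_abs s powr \<nu>) powr (\<delta> - 1)\<bar>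
          \<le> c n * ?P powr - of_int (padic_level s + sh n)"
        unfolding c_def M_def sh_def
        by (intro EK2_kernel_bound[OF P \<open>\<nu> > 0\<close> \<open>\<delta> > 0\<close>] padic_abs_eq_level[OF s])
    qed (rule EK_kernel_measurable)
    ultimately show "\<exists>C>0. \<forall>f\<in>cesaro_morrey \<mu> \<beta> r q.
               (\<forall>s. s \<noteq> 0 \<longrightarrow> set_integrable \<mu> (EK2_domain s) (EK2_integrand \<nu> \<gamma> \<delta> f s)) \<and>
               cesaro_morrey_norm \<mu> \<beta> r q (EK2 \<mu> \<nu> \<gamma> \<delta> f)
                 \<le> ennreal C * cesaro_morrey_norm \<mu> \<beta> r q f"
      by blast
  qed
qed

end
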